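(* Let $J_0$ be a Jacobi matrix on a finite connected graph $\mathcal G_0$ with $p$ vertices and without vertices of degree $1$, let $\ell$ be the first Betti number of $\mathcal G_0$, $d=2\ell$, and fix a choice of edges $e_1,\dots,e_\ell$ of $\mathcal G_0$ whose removal turns $\mathcal G_0$ into a tree, with associated $p\times p$ matrices $B$, $A_1,\dots,A_\ell$ and $A=\sum_{i=1}^\ell(A_i+A_i^* )$. Let $J$ be the lift of $J_0$ to a finite cover of $\mathcal G_0$, viewed as acting on $L^2(G,\mathbb C^p)$, where $G$ is the finite $d$-regular skeleton graph of the cover, by $$(Jx)_u=Bx_u+\sum_{i=1}^{\ell}\left(A_i x_{u+e_i}+A_i^*x_{u-e_i}\right).$$ Let $r\geq 1$ be an integer, and suppose that there exist a fixed $j\in\{1,\dots,\ell\}$ and a pair of edges $\epsilon_1,\epsilon_2\in E(G)$, each weighted by either $A_j$ or $A_j^*$, such that the distance in $G$ between the ends of $\epsilon_1$ and the ends of $\epsilon_2$ is greater than $2r+2$. Let $y\in\mathbb C^p$ be the normalized Perron-Frobenius eigenvector of $J_0$. Then $$\lambda_1(J)-\lambda_2(J)\ \le\ \left(d-2\sqrt{d-1}\right)\frac{\langle Ay,y\rangle}{d}+\frac{C_j}{r},$$ where $$C_j=(2\sqrt{d-1}-1)\frac{\langle Ay,y\rangle}{d}+\left|\frac{\langle Ay,y\rangle}{d}-\langle A_jy,y\rangle\right|.$$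
   Context: Graphs are undirected; multiple edges and loops are allowed; vertices of degree $1$ are not allowed (a loop contributes $2$ to the degree). A Jacobi matrix on a graph with vertex set $V$ and edge set $E$ is given by positive numbers $\{a_e\}_{e\in E}$ and real numbers $\{b_v\}_{v\in V}$, and is the operator on $L^2(V)$ with matrix entries $J_{v,v}=b_v+2\sum_{e\text{ a loop at }v}a_e$; $J_{v,w}=\sum_{e\text{ between }v\text{ and }w}a_e$ (sum over all edges joining $v$ and $w$) if $v\ne w$ are neighbors; and $J_{v,w}=0$ if $v\neq w$ are not neighbors. If $\pi:\mathcal G\to\mathcal G_0$ is a graph covering, the lift of $J_0$ (with parameters $\{a_e,b_v\}$) to $\mathcal G$ is the Jacobi matrix with parameters $a_{\tilde e}=a_{\pi(\tilde e)}$, $b_{\tilde v}=b_{\pi(\tilde v)}$. $\lambda_1(J)\ge\lambda_2(J)\ge\cdots$ are the eigenvalues counted with multiplicity. The normalized Perron-Frobenius eigenvector of $J_0$ is the unit eigenvector with positive entries associated with the top eigenvalue $\lambda_1(J_0)$. Block ("lego block") description. Let $\ell$ be the first Betti number (number of independent closed paths) of $\mathcal G_0$, $d=2\ell$, and choose edges $e_1,\dots,e_\ell$ whose removal turns $\mathcal G_0$ into a tree (the choice is not unique). Let $B$ be the $p\times p$ matrix which is the restriction of $J_0$ to this tree (diagonal entries $b_v$, off-diagonal entries from the remaining edges). Choose a direction for each $e_i$ and let $A_i$ be the $p\times p$ matrix with $(A_i)_{vw}=a_{e_i}$ if $v$ is the initial vertex and $w$ the terminal vertex of $e_i$, all other entries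 $0$ (if $e_i$ is a loop at $v$, then $A_i=A_i^*$ has $a_{e_i}$ at the diagonal entry of $v$). Then $J_0=B+\sum_{i=1}^\ell(A_i+A_i^* )=B+A$. Any cover of $\mathcal G_0$ is obtained by placing a copy of the block (the tree above together with the $2\ell$ half-edges $e_i^{\pm}$ obtained by cutting each $e_i$ in half) at each vertex of a $d$-regular graph $G$ (the skeleton; loops and multiple edges allowed) and gluing, along each edge of $G$, a half-edge $e_i^+$ of one block to a half-edge $e_i^-$ of another (or the same) block, for the same $i$. Thus for each $i$ there is a permutation $u\mapsto u+e_i$ of $V(G)$ with inverse $u\mapsto u-e_i$, the edges of $G$ are the pairs $(u,u+e_i)$, and $\{u\pm e_i\}_{i=1}^\ell$ are the $d$ neighbors of $u$. The edge between $u$ and $u+e_i$ is said to be weighted by $A_i$ (or by $A_i^*$, when traversed in the opposite direction). $L^2(G,\mathbb C^p)$ is the space of $\mathbb C^p$-valued functions $x=(x_u)_{u\in V(G)}$, the component in $\mathbb C^p$ of $x_u$ giving the values on the block at $u$. *)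

theory Defs
  imports "HOL-Analysis.Analysis" "HOL-Library.Extended_Nat" "HOL-Library.Multiset"
begin

section \<open>Undirected multigraphs with loops\<close>

text \<open>
  The vertex set is the whole type \<open>'v\<close>.  Every undirected edge is stored with an arbitrary
  reference direction.  The notions below other than \<open>half_edge\<close>, \<open>is_cover\<close> and \<open>lego_cover\<close> do
  not depend on it; for a distinguished edge $e_i$ it is the direction that is chosen for $e_i$.
\<close>

record ('v, 'e) mgraph =
  edges :: "'e set"
  src :: "'e \<Rightarrow> 'v"
  tgt :: "'e \<Rightarrow> 'v"

definition degree :: "('v, 'e::finite) mgraph \<Rightarrow> 'v \<Rightarrow> nat" where
  "degree G v = card {e \<in> edges G. src G e = v} + card {e \<in> edges G. tgt G e = v}"

definition del_edges :: "('v, 'e) mgraph \<Rightarrow> 'e set \<Rightarrow> ('v, 'e) mgraph" where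
  "del_edges G S = G\<lparr>edges := edges G - S\<rparr>"

text \<open>The Boolean says whether an edge is traversed along or against its reference direction.\<close>

fun walk :: "('v, 'e) mgraph \<Rightarrow> 'v \<Rightarrow> ('e \<times> bool) list \<Rightarrow> 'v \<Rightarrow> bool" where
  "walk G x [] y \<longleftrightarrow> x = y"
| "walk G x ((e, s) # es) y \<longleftrightarrow> e \<in> edges G \<and> x = (if s then src G e else tgt G e) \<and>
     walk G (if s then tgt G e else src G e) es y"

definition conn :: "('v, 'e) mgraph \<Rightarrow> bool" where
  "conn G \<longleftrightarrow> (\<forall>x y. \<exists>es. walk G x es y)"

definition is_tree :: "('v, 'e) mgraph \<Rightarrow> bool" where
  "is_tree G \<longleftrightarrow> conn G \<and> (\<nexists>x es. es \<noteq> [] \<and> distinct (map fst es) \<and> walk G x es x)"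

text \<open>The distance is \<open>\<infinity>\<close> between different connected components.\<close>

definition gdist :: "('v, 'e) mgraph \<Rightarrow> 'v \<Rightarrow> 'v \<Rightarrow> enat" where
  "gdist G x y = (INF es\<in>{es. walk G x es y}. enat (length es))"

definition ends :: "('v, 'e) mgraph \<Rightarrow> 'e \<Rightarrow> 'v set" where
  "ends G e = {src G e, tgt G e}"

text \<open>The first Betti number: the dimension of the cycle space $H_1(G,\mathbf{R})$.\<close>

definition betti1 :: "('v, 'e::finite) mgraph \<Rightarrow> nat" where
  "betti1 G = dim {c :: real ^ 'e. (\<forall>e. e \<notin> edges G \<longrightarrow> c $ e = 0) \<and>
     (\<forall>v. (\<Sum>e | e \<in> edges G \<and> tgt G e = v. c $ e) = (\<Sum>e | e \<in> edges G \<and> src G e = v. c $ e))}"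


section \<open>Jacobi matrices and their eigenvalues\<close>

definition jacobi ::
    "('v::finite, 'e::finite) mgraph \<Rightarrow> ('e \<Rightarrow> real) \<Rightarrow> ('v \<Rightarrow> real) \<Rightarrow> complex ^ 'v ^ 'v" where
  "jacobi G a b = (\<chi> v w. complex_of_real (
     if v = w then b v + 2 * (\<Sum>e | e \<in> edges G \<and> src G e = v \<and> tgt G e = v. a e)
     else (\<Sum>e | e \<in> edges G \<and> {src G e, tgt G e} = {v, w}. a e)))"

definition cadjoint :: "complex ^ 'n ^ 'm \<Rightarrow> complex ^ 'm ^ 'n" where
  "cadjoint M = (\<chi> i j. cnj (M $ j $ i))"

text \<open>The matrix $A_i$ when \<open>e\<close> is the edge $e_i$; the row is the initial vertex.\<close>

definition half_edge :: "('v::finite, 'e) mgraph \<Rightarrow> ('e \<Rightarrow> real) \<Rightarrow> 'e \<Rightarrow> complex ^ 'v ^ 'v" where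
  "half_edge G a e = (\<chi> v w. if v = src G e \<and> w = tgt G e then complex_of_real (a e) else 0)"

text \<open>
  The real eigenvalues of a linear operator, each as often as the dimension over the complex
  numbers of its eigenspace.  For a self-adjoint operator these are all the eigenvalues, counted
  with multiplicity.  \<open>eigval k T\<close> is the \<open>k\<close>-th largest one, counting from \<open>k = 1\<close>.
\<close>

definition eigenspace :: "(complex ^ 'n \<Rightarrow> complex ^ 'n) \<Rightarrow> real \<Rightarrow> (complex ^ 'n) set" where
  "eigenspace T t = {x. T x = complex_of_real t *s x}"

definition eigenvalues :: "(complex ^ 'n::finite \<Rightarrow> complex ^ 'n) \<Rightarrow> real multiset" where
  "eigenvalues T = (\<Sum>t | eigenspace T t \<noteq> {0}. replicate_mset (vec.dim (eigenspace T t)) t)"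

definition eigval :: "nat \<Rightarrow> (complex ^ 'n::finite \<Rightarrow> complex ^ 'n) \<Rightarrow> real" where
  "eigval k T = rev (sorted_list_of_multiset (eigenvalues T)) ! (k - 1)"

text \<open>
  The library's inner product \<open>\<bullet>\<close> on \<open>complex ^ 'n\<close> is the real part of the Hermitian one, and its
  norm is the Hermitian norm.  For real matrices \<open>M\<close> and real \<open>y\<close>, \<open>(M *v y) \<bullet> y\<close> is
  therefore $\langle My, y\rangle$.
\<close>

definition perron_frobenius :: "complex ^ 'n::finite ^ 'n \<Rightarrow> complex ^ 'n \<Rightarrow> bool" where
  "perron_frobenius M y \<longleftrightarrow> norm y = 1 \<and> (\<forall>v. y $ v \<in> \<real> \<and> Re (y $ v) > 0) \<and>
     M *v y = complex_of_real (eigval 1 ((*v) M)) *s y"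


section \<open>Covers and their skeletons\<close>

text \<open>
  A covering map \<open>(prV, prE)\<close> from \<open>H\<close> to \<open>G\<close>.  Edges of \<open>H\<close> carry the reference direction pulled
  back from \<open>G\<close>, which is no restriction, since a covering maps each edge homeomorphically.  The two
  conditions on stars together say that it is a local homeomorphism; a loop at \<open>v\<close> is both an
  outgoing and an incoming edge of \<open>v\<close>.  \<open>H\<close> need not be connected.
\<close>

definition is_cover ::
    "('w, 'f) mgraph \<Rightarrow> ('v, 'e) mgraph \<Rightarrow> ('w \<Rightarrow> 'v) \<Rightarrow> ('f \<Rightarrow> 'e) \<Rightarrow> bool" where
  "is_cover H G prV prE \<longleftrightarrow> surj prV \<and>
     (\<forall>f\<in>edges H. prE f \<in> edges G \<and> src G (prE f) = prV (src H f) \<and> tgt G (prE f) = prV (tgt H f)) \<and>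
     (\<forall>w. bij_betw prE {f \<in> edges H. src H f = w} {e \<in> edges G. src G e = prV w}) \<and>
     (\<forall>w. bij_betw prE {f \<in> edges H. tgt H f = w} {e \<in> edges G. tgt G e = prV w})"

text \<open>
  The decomposition of a cover \<open>H\<close> into blocks, where \<open>es 1, \<dots>, es l\<close> are the edges that are cut:
  \<open>blk w\<close> is the vertex of the skeleton whose block contains the vertex \<open>w\<close>, and \<open>shift i u\<close> is
  $u + e_i$.  The block at \<open>u\<close> has exactly one vertex above each vertex of \<open>G\<close>; lifts of tree edges
  stay within a block, and a lift of $e_i$ that starts in the block at \<open>u\<close> ends in the one
  at $u + e_i$.
\<close>

definition lego_cover ::
    "('w, 'f) mgraph \<Rightarrow> ('v, 'e) mgraph \<Rightarrow> ('w \<Rightarrow> 'v) \<Rightarrow> ('f \<Rightarrow> 'e) \<Rightarrow> nat \<Rightarrow> (nat \<Rightarrow> 'e) \<Rightarrow>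
     ('w \<Rightarrow> 'u) \<Rightarrow> (nat \<Rightarrow> 'u \<Rightarrow> 'u) \<Rightarrow> bool" where
  "lego_cover H G prV prE l es blk shift \<longleftrightarrow> is_cover H G prV prE \<and>
     bij (\<lambda>w. (blk w, prV w)) \<and>
     (\<forall>i\<in>{1..l}. bij (shift i)) \<and>
     (\<forall>f\<in>edges H. prE f \<notin> es ` {1..l} \<longrightarrow> blk (tgt H f) = blk (src H f)) \<and>
     (\<forall>f\<in>edges H. \<forall>i\<in>{1..l}. prE f = es i \<longrightarrow> blk (tgt H f) = shift i (blk (src H f)))"

text \<open>The skeleton graph; its edge \<open>(u, i)\<close> joins $u$ and $u + e_i$.\<close>

definition skeleton :: "nat \<Rightarrow> (nat \<Rightarrow> 'u \<Rightarrow> 'u) \<Rightarrow> ('u, 'u \<times> nat) mgraph" where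
  "skeleton l shift = \<lparr>edges = UNIV \<times> {1..l}, src = fst, tgt = (\<lambda>(u, i). shift i u)\<rparr>"

text \<open>
  A vector \<open>x :: complex ^ ('u \<times> 'v)\<close> is an element of $L^2(G, \mathbf{C}^p)$; \<open>at_vertex x u\<close> is its
  value at \<open>u\<close>, and \<open>spread\<close> is the identification with $L^2$ of the vertex set of the cover.
\<close>

definition at_vertex :: "complex ^ ('u::finite \<times> 'v::finite) \<Rightarrow> 'u \<Rightarrow> complex ^ 'v" where
  "at_vertex x u = (\<chi> v. x $ (u, v))"

definition spread ::
    "('w \<Rightarrow> 'u) \<Rightarrow> ('w \<Rightarrow> 'v) \<Rightarrow> complex ^ ('u::finite \<times> 'v::finite) \<Rightarrow> complex ^ 'w" where
  "spread blk prV x = (\<chi> w. x $ (blk w, prV w))"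


section \<open>Block form of the base matrix and of its lifts\<close>

lemma jacobi_apply:
  fixes G :: "('v::finite, 'e::finite) mgraph"
  shows "(jacobi G a b *v x) $ v = of_real (b v) * x $ v
     + (\<Sum>e | e \<in> edges G \<and> src G e = v. of_real (a e) * x $ tgt G e)
     + (\<Sum>e | e \<in> edges G \<and> tgt G e = v. of_real (a e) * x $ src G e)"
proof -
  have ent: "jacobi G a b $ v $ w = (if w = v then of_real (b v) else 0)
      + (\<Sum>e | e \<in> edges G \<and> src G e = v. if w = tgt G e then of_real (a e) else 0)
      + (\<Sum>e | e \<in> edges G \<and> tgt G e = v. if w = src G e then of_real (a e) else 0)" for w
  proof -
    have s1: "(\<Sum>e | e \<in> edges G \<and> src G e = v. if w = tgt G e then complex_of_real (a e) else 0)
       = (\<Sum>e | e \<in> edges G \<and> src G e = v \<and> tgt G e = w. of_real (a e))"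
      by (rule sum.mono_neutral_cong_right) auto
    have s2: "(\<Sum>e | e \<in> edges G \<and> tgt G e = v. if w = src G e then complex_of_real (a e) else 0)
       = (\<Sum>e | e \<in> edges G \<and> tgt G e = v \<and> src G e = w. of_real (a e))"
      by (rule sum.mono_neutral_cong_right) auto
    show ?thesis
    proof (cases "w = v")
      case True
      have "{e. e \<in> edges G \<and> tgt G e = v \<and> src G e = v} = {e. e \<in> edges G \<and> src G e = v \<and> tgt G e = v}"
        by auto
      then show ?thesis unfolding s1 s2 using True by (simp add: jacobi_def)
    next
      case False
      have "{e. e \<in> edges G \<and> {src G e, tgt G e} = {v, w}}
          = {e. e \<in> edges G \<and> src G e = v \<and> tgt G e = w} \<union> {e. e \<in> edges G \<and> tgt G e = v \<and> src G e = w}"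
        by (auto simp: doubleton_eq_iff)
      moreover have "{e. e \<in> edges G \<and> src G e = v \<and> tgt G e = w}
          \<inter> {e. e \<in> edges G \<and> tgt G e = v \<and> src G e = w} = {}"
        using False by auto
      ultimately show ?thesis unfolding s1 s2 using False
        by (simp add: jacobi_def sum.union_disjoint)
    qed
  qed
  have p1: "(\<Sum>w\<in>UNIV. (if w = v then of_real (b v) else 0) * x $ w) = of_real (b v) * x $ v"
    by (simp add: if_distrib[of "\<lambda>t. t * _"] cong: if_cong)
  have p2: "(\<Sum>w\<in>UNIV. (\<Sum>e\<in>S. if w = h e then complex_of_real (a e) else 0) * x $ w)
     = (\<Sum>e\<in>S. of_real (a e) * x $ h e)" for S and h :: "'e \<Rightarrow> 'v"
    unfolding sum_distrib_right
    by (subst sum.swap) (simp add: if_distrib[of "\<lambda>t. t * _"] cong: if_cong)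
  show ?thesis
    unfolding matrix_vector_mult_def by (simp add: ent distrib_right sum.distrib p1 p2)
qed

lemma half_edge_apply:
  "(half_edge G a e *v z) $ v = (if src G e = v then of_real (a e) * z $ tgt G e else 0)"
  "(cadjoint (half_edge G a e) *v z) $ v = (if tgt G e = v then of_real (a e) * z $ src G e else 0)"
  unfolding matrix_vector_mult_def half_edge_def cadjoint_def
  by (auto simp: if_distrib[of "\<lambda>t. t * _"] if_distrib[of cnj] cong: if_cong)

lemma sum_split_edges:
  fixes G :: "('v, 'e::finite) mgraph" and g :: "'e \<Rightarrow> complex" and h :: "'e \<Rightarrow> 'v"
    and es :: "nat \<Rightarrow> 'e"
  assumes "inj_on es {1..l}" "es ` {1..l} \<subseteq> edges G"
  shows "(\<Sum>e | e \<in> edges G \<and> h e = v. g e)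
     = (\<Sum>e | e \<in> edges G \<and> e \<notin> es ` {1..l} \<and> h e = v. g e)
       + (\<Sum>i\<in>{1..l}. if h (es i) = v then g (es i) else 0)"
proof -
  have "{e. e \<in> edges G \<and> h e = v} = {e. e \<in> edges G \<and> e \<notin> es ` {1..l} \<and> h e = v}
      \<union> {e \<in> es ` {1..l}. h e = v}"
    using assms(2) by auto
  then have "(\<Sum>e | e \<in> edges G \<and> h e = v. g e)
     = (\<Sum>e | e \<in> edges G \<and> e \<notin> es ` {1..l} \<and> h e = v. g e) + (\<Sum>e\<in>{e \<in> es ` {1..l}. h e = v}. g e)"
    by (simp only:) (rule sum.union_disjoint, auto)
  also have "(\<Sum>e\<in>{e \<in> es ` {1..l}. h e = v}. g e) = (\<Sum>e\<in>es ` {1..l}. if h e = v then g e else 0)"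
    by (rule sum.mono_neutral_cong_left) auto
  finally show ?thesis unfolding sum.reindex[OF assms(1)] o_def .
qed

lemma jacobi_split:
  fixes G :: "('v::finite, 'e::finite) mgraph" and es :: "nat \<Rightarrow> 'e"
  assumes "inj_on es {1..l}" "es ` {1..l} \<subseteq> edges G"
  shows "jacobi G a b = jacobi (del_edges G (es ` {1..l})) a b
     + (\<Sum>i\<in>{1..l}. half_edge G a (es i) + cadjoint (half_edge G a (es i)))"
proof -
  have sv: "((\<Sum>i\<in>I. M i) *v x) = (\<Sum>i\<in>I. M i *v x)" if "finite I"
    for I :: "nat set" and M :: "nat \<Rightarrow> complex ^ 'v ^ 'v" and x
    using that by (induction I) (auto simp: matrix_vector_mult_add_rdistrib)
  show ?thesis
    unfolding matrix_eq matrix_vector_mult_add_rdistrib sv[OF finite_atLeastAtMost]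
    by (simp add: vec_eq_iff jacobi_apply sum_split_edges[OF assms] half_edge_apply sum.distrib
        del_edges_def conj_assoc)
qed

text \<open>The block formula for the lift is a consequence of \<open>lego_cover\<close>.\<close>

lemma lift_block_form:
  fixes H :: "('w::finite, 'f::finite) mgraph" and G :: "('v::finite, 'e::finite) mgraph"
    and x :: "complex ^ ('u::finite \<times> 'v)"
  assumes lego: "lego_cover H G prV prE l es blk shift"
    and es: "inj_on es {1..l}" "es ` {1..l} \<subseteq> edges G"
    and lift: "spread blk prV y = jacobi H (a \<circ> prE) (b \<circ> prV) *v spread blk prV x"
  shows "at_vertex y u = jacobi (del_edges G (es ` {1..l})) a b *v at_vertex x u
     + (\<Sum>i\<in>{1..l}. half_edge G a (es i) *v at_vertex x (shift i u)
          + cadjoint (half_edge G a (es i)) *v at_vertex x (inv (shift i) u))"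
  unfolding vec_eq_iff
proof
  fix v
  let ?S = "es ` {1..l}"
  have cov: "is_cover H G prV prE" and bb: "bij (\<lambda>w. (blk w, prV w))"
    and sh: "\<And>i. i \<in> {1..l} \<Longrightarrow> bij (shift i)"
    and tr: "\<And>f. f \<in> edges H \<Longrightarrow> prE f \<notin> ?S \<Longrightarrow> blk (tgt H f) = blk (src H f)"
    and st: "\<And>f i. f \<in> edges H \<Longrightarrow> i \<in> {1..l} \<Longrightarrow> prE f = es i \<Longrightarrow> blk (tgt H f) = shift i (blk (src H f))"
    using lego by (auto simp: lego_cover_def)
  obtain w where "(blk w, prV w) = (u, v)"
    using bij_is_surj[OF bb] by (metis (mono_tags) surjE)
  then have w: "blk w = u" "prV w = v" by auto
  have ends: "\<And>f. f \<in> edges H \<Longrightarrow> prV (src H f) = src G (prE f)"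
    "\<And>f. f \<in> edges H \<Longrightarrow> prV (tgt H f) = tgt G (prE f)"
    and out: "bij_betw prE {f. f \<in> edges H \<and> src H f = w} {e. e \<in> edges G \<and> src G e = v}"
    and inn: "bij_betw prE {f. f \<in> edges H \<and> tgt H f = w} {e. e \<in> edges G \<and> tgt G e = v}"
    using cov w by (auto simp: is_cover_def)
  define idx where "idx = the_inv_into {1..l} es"
  have idx: "idx (es i) = i" if "i \<in> {1..l}" for i
    using that es(1) by (simp add: idx_def the_inv_into_f_f)
  define po where "po e = (if e \<in> ?S then shift (idx e) u else u)" for e
  define qi where "qi e = (if e \<in> ?S then inv (shift (idx e)) u else u)" for e
  have bo: "blk (tgt H f) = po (prE f)" if "f \<in> edges H" "src H f = w" for f
    using that tr[of f] st[of f] w by (auto simp: po_def idx)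
  have bi: "blk (src H f) = qi (prE f)" if f: "f \<in> edges H" "tgt H f = w" for f
  proof (cases "prE f \<in> ?S")
    case True
    then obtain i where i: "i \<in> {1..l}" "prE f = es i" by auto
    have "u = shift i (blk (src H f))" using st[OF f(1) i] f w by simp
    then have "inv (shift i) u = blk (src H f)"
      using sh[OF i(1)] by (simp add: bij_is_inj)
    moreover have "qi (es i) = inv (shift i) u"
      using i(1) idx[OF i(1)] by (auto simp: qi_def)
    ultimately show ?thesis using i by simp
  next
    case False
    then show ?thesis using f tr[of f] w by (simp add: qi_def)
  qed
  have o: "(\<Sum>f | f \<in> edges H \<and> src H f = w. of_real ((a \<circ> prE) f) * spread blk prV x $ tgt H f)
     = (\<Sum>e | e \<in> edges G \<and> src G e = v. of_real (a e) * x $ (po e, tgt G e))"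
    by (subst sum.reindex_bij_betw[OF out, symmetric])
       (rule sum.cong, auto simp: spread_def bo ends)
  have i: "(\<Sum>f | f \<in> edges H \<and> tgt H f = w. of_real ((a \<circ> prE) f) * spread blk prV x $ src H f)
     = (\<Sum>e | e \<in> edges G \<and> tgt G e = v. of_real (a e) * x $ (qi e, src G e))"
    by (subst sum.reindex_bij_betw[OF inn, symmetric])
       (rule sum.cong, auto simp: spread_def bi ends)
  note sp = sum_split_edges[OF es]
  have "at_vertex y u $ v = spread blk prV y $ w"
    by (simp add: at_vertex_def spread_def w)
  also have "\<dots> = of_real (b v) * x $ (u, v)
     + (\<Sum>e | e \<in> edges G \<and> src G e = v. of_real (a e) * x $ (po e, tgt G e))
     + (\<Sum>e | e \<in> edges G \<and> tgt G e = v. of_real (a e) * x $ (qi e, src G e))"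
    unfolding lift jacobi_apply o i by (simp add: spread_def w)
  also have "(\<Sum>e | e \<in> edges G \<and> src G e = v. of_real (a e) * x $ (po e, tgt G e))
     = (\<Sum>e | e \<in> edges G \<and> e \<notin> ?S \<and> src G e = v. of_real (a e) * x $ (u, tgt G e))
      + (\<Sum>i\<in>{1..l}. (half_edge G a (es i) *v at_vertex x (shift i u)) $ v)"
    unfolding sp[where h = "src G"] half_edge_apply
    by (intro arg_cong2[where f = "(+)"] sum.cong) (auto simp: po_def idx at_vertex_def)
  also have "(\<Sum>e | e \<in> edges G \<and> tgt G e = v. of_real (a e) * x $ (qi e, src G e))
     = (\<Sum>e | e \<in> edges G \<and> e \<notin> ?S \<and> tgt G e = v. of_real (a e) * x $ (u, src G e))
      + (\<Sum>i\<in>{1..l}. (cadjoint (half_edge G a (es i)) *v at_vertex x (inv (shift i) u)) $ v)"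
    unfolding sp[where h = "tgt G"] half_edge_apply
    by (intro arg_cong2[where f = "(+)"] sum.cong) (auto simp: qi_def idx at_vertex_def)
  finally show "at_vertex y u $ v = (jacobi (del_edges G ?S) a b *v at_vertex x u
     + (\<Sum>i\<in>{1..l}. half_edge G a (es i) *v at_vertex x (shift i u)
          + cadjoint (half_edge G a (es i)) *v at_vertex x (inv (shift i) u))) $ v"
    by (simp add: jacobi_apply del_edges_def conj_assoc sum.distrib at_vertex_def add_ac)
qed

end

theory Submission
  imports Defs
begin

text \<open>
  The constant lift of $y$ is a positive eigenvector of $J$ for the eigenvalue
  $t = \lambda_1(J_0)$, so no eigenvalue of $J$ exceeds $t$.  For the second eigenvalue, take the test
  vectors $x_u = f(u) y$, for which $\langle Jx, x\rangle$ only involves the numbers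
  $\alpha_i = \langle A_i y, y\rangle$.  On the $d$-regular tree, Nilli's radial function
  $(d-1)^{-k/2}$ of the distance $k < r$ to an edge of type $j$ has the required Rayleigh quotient:
  the total weight $w_k$ of the edges that join the layers $k - 1$ and $k$ satisfies
  $w_{k+1} + w_k = 2 (d-1)^k \langle Ay, y\rangle$, so that it deviates from its average by an
  error that only alternates in sign.  The function is carried to $G$ by
  $f(u) = (\sum F(t)^2)^{1/2}$, the sum over the tree vertices $t$ above $u$; this keeps the norm,
  and by the Cauchy-Schwarz inequality it can only increase $\langle Jx, x\rangle$.  The test functions
  at the two edges have disjoint non-adjacent supports, and some combination of them is orthogonal
  to the constant lift of $y$.
\<close>

section \<open>Eigenvalues of self-adjoint operators\<close>

lemma rev_sorted_nth_0_le:
  fixes c :: "'a::linorder"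
  assumes "M \<noteq> {#}" and "\<And>x. x \<in># M \<Longrightarrow> x \<le> c"
  shows "rev (sorted_list_of_multiset M) ! 0 \<le> c"
proof -
  have "length (rev (sorted_list_of_multiset M)) > 0"
    using assms(1) by (metis length_greater_0_conv mset.simps(1) mset_rev mset_sorted_list_of_multiset)
  then have "rev (sorted_list_of_multiset M) ! 0 \<in> set (rev (sorted_list_of_multiset M))"
    by (rule nth_mem)
  then show ?thesis using assms(2) by simp
qed

lemma rev_sorted_nth_1_ge:
  fixes s t :: "'a::linorder"
  assumes "{#s, t#} \<subseteq># M" and "t \<le> s"
  shows "t \<le> rev (sorted_list_of_multiset M) ! 1"
proof -
  define xs where "xs = rev (sorted_list_of_multiset M)"
  have xs: "mset xs = M" by (simp add: xs_def)
  have sorted: "sorted_wrt (\<ge>) xs" by (simp add: xs_def sorted_wrt_rev)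
  have "2 \<le> length xs"
    using size_mset_mono[OF assms(1)] by (simp add: xs[symmetric])
  then obtain p q zs where pq: "xs = p # q # zs"
    by (metis One_nat_def Suc_1 Suc_le_length_iff)
  \<comment> \<open>Otherwise the head \<open>p\<close> alone could be at least \<open>t\<close>,
    whereas \<open>s\<close> and \<open>t\<close> are two such elements.\<close>
  have "t \<le> q"
  proof (rule ccontr)
    assume "\<not> t \<le> q"
    then have "\<forall>x\<in>set (q # zs). \<not> t \<le> x"
      using sorted pq by fastforce
    then have "filter_mset (\<lambda>x. t \<le> x) (mset (q # zs)) = {#}"
      by (auto simp: multiset_eq_iff not_in_iff)
    then have "size (filter_mset (\<lambda>x. t \<le> x) M) \<le> 1"
      unfolding xs[symmetric] pq by simp
    moreover have "{#s, t#} \<subseteq># filter_mset (\<lambda>x. t \<le> x) M"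
      using multiset_filter_mono[OF assms(1), of "\<lambda>x. t \<le> x"] assms(2) by simp
    ultimately show False
      using size_mset_mono by fastforce
  qed
  then show ?thesis using pq by (simp add: xs_def)
qed

text \<open>Rayleigh's principle: a maximizer of the Rayleigh quotient on the unit sphere of the
  invariant subspace \<open>W\<close> is an eigenvector, and its eigenvalue is the maximum, hence at
  least the quotient of \<open>z\<close>.\<close>

lemma self_adjoint_eigenvector_ge:
  fixes T :: "'a::euclidean_space \<Rightarrow> 'a"
  assumes lin: "linear T" and sa: "\<And>x y. T x \<bullet> y = x \<bullet> T y"
    and W: "subspace W" "\<And>x. x \<in> W \<Longrightarrow> T x \<in> W"
    and z: "z \<in> W" "z \<noteq> 0" "c * (z \<bullet> z) \<le> T z \<bullet> z"
  obtains x \<mu> where "x \<in> W" "x \<noteq> 0" "T x = \<mu> *\<^sub>R x" "c \<le> \<mu>"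
proof -
  let ?K = "sphere 0 1 \<inter> W"
  have norm_in: "(1 / norm w) *\<^sub>R w \<in> ?K" if "w \<in> W" "w \<noteq> 0" for w
    using that W(1) by (simp add: subspace_scale)
  have "compact ?K" by (intro compact_Int_closed compact_sphere closed_subspace W)
  moreover have "?K \<noteq> {}" using norm_in[OF z(1,2)] by blast
  moreover have "continuous_on ?K (\<lambda>x. T x \<bullet> x)"
    by (intro continuous_intros linear_continuous_on linear_conv_bounded_linear[THEN iffD1] lin)
  ultimately obtain x where x: "x \<in> ?K" "\<And>w. w \<in> ?K \<Longrightarrow> T w \<bullet> w \<le> T x \<bullet> x"
    using continuous_attains_sup[of ?K "\<lambda>x. T x \<bullet> x"] by blast
  define \<mu> where "\<mu> = T x \<bullet> x"
  have "norm x = 1" "x \<in> W" using x(1) by auto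
  then have xx: "x \<bullet> x = 1" "x \<in> W" "x \<noteq> 0" by (auto simp: dot_square_norm)
  have le: "T w \<bullet> w \<le> \<mu> * (w \<bullet> w)" if "w \<in> W" for w
  proof (cases "w = 0")
    case False
    have "T ((1 / norm w) *\<^sub>R w) \<bullet> ((1 / norm w) *\<^sub>R w) \<le> \<mu>"
      using x(2)[OF norm_in[OF that False]] by (simp add: \<mu>_def)
    then show ?thesis using False
      by (simp add: linear_scale[OF lin] divide_simps power2_norm_eq_inner[symmetric] power2_eq_square)
  qed (simp add: linear_0[OF lin])
  \<comment> \<open>The form \<open>\<mu> * (v \<bullet> v) - T v \<bullet> v\<close> is nonnegative
    on \<open>W\<close> and vanishes at \<open>x\<close>, where its gradient is
    \<open>2 *\<^sub>R g\<close>. Moving from \<open>x\<close> in the direction \<open>- g\<close>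
    would make it negative unless \<open>g = 0\<close>.\<close>
  define g where "g = \<mu> *\<^sub>R x - T x"
  have g: "g \<in> W" using xx W by (simp add: g_def subspace_diff subspace_scale)
  define k where "k = \<mu> * (g \<bullet> g) - T g \<bullet> g"
  have q: "0 \<le> t * t * k - 2 * t * (g \<bullet> g)" for t
  proof -
    have "x - t *\<^sub>R g \<in> W" using xx g W(1) by (simp add: subspace_diff subspace_scale)
    from le[OF this] have "0 \<le> \<mu> * ((x - t *\<^sub>R g) \<bullet> (x - t *\<^sub>R g)) - T (x - t *\<^sub>R g) \<bullet> (x - t *\<^sub>R g)"
      by simp
    also have "\<dots> = (\<mu> - \<mu>) + t * t * k - 2 * t * (\<mu> * (x \<bullet> g) - T x \<bullet> g)"
      using xx(1) sa[of g x] unfolding k_def \<mu>_def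
      by (simp add: linear_diff[OF lin] linear_scale[OF lin] inner_diff inner_commute algebra_simps)
    also have "\<mu> * (x \<bullet> g) - T x \<bullet> g = g \<bullet> g"
      by (simp add: g_def inner_diff_left)
    finally show ?thesis by simp
  qed
  have "g = 0"
  proof (rule ccontr)
    assume "g \<noteq> 0"
    then have p: "g \<bullet> g > 0" by simp
    \<comment> \<open>So small that the quadratic term \<open>t * t * k\<close> is at most half of
      the linear term.\<close>
    define t where "t = (g \<bullet> g) / (\<bar>k\<bar> + 1)"
    have t: "t > 0" "t * (\<bar>k\<bar> + 1) = g \<bullet> g" using p by (auto simp: t_def)
    have "t * k \<le> g \<bullet> g" unfolding t(2)[symmetric] using t(1) by (intro mult_left_mono) auto
    then have "t * (t * k) \<le> t * (g \<bullet> g)" using t(1) by simp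
    moreover have "t * (g \<bullet> g) > 0" using t(1) p by simp
    ultimately show False using q[of t] by (simp add: mult.assoc)
  qed
  then have "T x = \<mu> *\<^sub>R x" by (simp add: g_def)
  moreover have "c \<le> \<mu>"
    using le[OF z(1)] z(2,3) by (meson inner_gt_zero_iff mult_le_cancel_right_pos order_trans)
  ultimately show thesis using that xx by blast
qed

lemma of_real_vector_mult: "complex_of_real t *s x = t *\<^sub>R x"
  by (simp add: vec_eq_iff scaleR_conv_of_real[where 'a = complex])

lemma inner_i_mult_left: "(\<i> *s x) \<bullet> y = - (x \<bullet> (\<i> *s y))" for x y :: "complex ^ 'n"
  by (simp add: inner_vec_def inner_complex_def sum_negf[symmetric] algebra_simps)

text \<open>The real inner product sees only the real part of the Hermitian one, so it takes two
  conditions to make \<open>z\<close> Hermitian orthogonal to \<open>w\<close>. Rayleigh's principle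
  on the complement of \<open>w\<close> gives an eigenvector with eigenvalue at least
  \<open>c\<close>; together with \<open>w\<close> it accounts for two entries of the list of
  eigenvalues.\<close>

lemma eigval_bounds:
  fixes T :: "complex ^ 'n \<Rightarrow> complex ^ 'n"
  assumes lin: "Vector_Spaces.linear (*s) (*s) T"
    and sa: "\<And>x y. T x \<bullet> y = x \<bullet> T y"
    and top: "T w = complex_of_real t *s w" "w \<noteq> 0"
    and max: "\<And>x \<mu>. x \<noteq> 0 \<Longrightarrow> T x = complex_of_real \<mu> *s x \<Longrightarrow> \<mu> \<le> t"
    and z: "z \<bullet> w = 0" "z \<bullet> (\<i> *s w) = 0" "z \<noteq> 0" "c * (z \<bullet> z) \<le> T z \<bullet> z"
  shows "eigval 1 T \<le> t" and "c \<le> eigval 2 T"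
proof -
  interpret T: Vector_Spaces.linear "(*s)" "(*s)" T by (rule lin)
  have rlin: "linear T"
    by (rule linearI) (simp_all add: T.add T.scale flip: of_real_vector_mult)
  have esp: "vec.subspace (eigenspace T s)" for s
    unfolding eigenspace_def vec.subspace_def
    by (auto simp: T.zero T.add T.scale vec.scale_right_distrib mult.commute)
  have nz: "eigenspace T s \<noteq> {0} \<longleftrightarrow> (\<exists>x\<in>eigenspace T s. x \<noteq> 0)" for s
    using vec.subspace_0[OF esp] by blast
  define S where "S = {s. eigenspace T s \<noteq> {0}}"
  define ev where "ev s = (SOME x. x \<in> eigenspace T s \<and> x \<noteq> 0)" for s
  have ev: "T (ev s) = s *\<^sub>R ev s" "ev s \<noteq> 0" if "s \<in> S" for s
    using someI_ex[of "\<lambda>x. x \<in> eigenspace T s \<and> x \<noteq> 0"] that nz[of s]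
    by (auto simp: S_def ev_def eigenspace_def of_real_vector_mult)
  \<comment> \<open>A sum over an infinite index set is empty by convention, so the sum in
    \<open>eigenvalues\<close> must be shown to be finite. Pairwise orthogonal nonzero eigenvectors
    give this.\<close>
  have orth: "ev s \<bullet> ev s' = 0" if "s \<in> S" "s' \<in> S" "s \<noteq> s'" for s s'
    using sa[of "ev s" "ev s'"] ev that by simp
  have "finite (ev ` S)"
    by (rule pairwise_orthogonal_imp_finite) (auto simp: pairwise_def orthogonal_def intro: orth)
  moreover have "inj_on ev S"
    using orth ev(2) by (metis inj_onI inner_eq_zero_iff)
  ultimately have fin: "finite S" by (rule finite_imageD)
  have evs: "eigenvalues T = (\<Sum>s\<in>S. replicate_mset (vec.dim (eigenspace T s)) s)"
    by (simp add: eigenvalues_def S_def)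
  have count: "count (eigenvalues T) s = (if s \<in> S then vec.dim (eigenspace T s) else 0)" for s
    unfolding evs using fin by (auto simp: count_sum)
  have mem: "\<mu> \<le> t" if "\<mu> \<in># eigenvalues T" for \<mu>
  proof -
    have "\<mu> \<in> S" using that count[of \<mu>] by (auto simp: count_eq_zero_iff split: if_splits)
    then show ?thesis using max[of "ev \<mu>" \<mu>] ev[of \<mu>] by (simp add: of_real_vector_mult)
  qed
  \<comment> \<open>The Hermitian complement of \<open>w\<close>, invariant because \<open>w\<close>
    and \<open>\<i> *s w\<close> are both eigenvectors.\<close>
  define W where "W = {x. x \<bullet> w = 0 \<and> x \<bullet> (\<i> *s w) = 0}"
  have W: "subspace W" by (auto simp: W_def subspace_def inner_add_left)
  have iw: "T (\<i> *s w) = t *\<^sub>R (\<i> *s w)"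
    unfolding T.scale top(1) of_real_vector_mult[symmetric] by (simp add: mult.commute)
  have inv: "T x \<in> W" if "x \<in> W" for x
    using that top(1) iw by (simp add: W_def sa of_real_vector_mult)
  obtain x \<mu> where x: "x \<in> W" "x \<noteq> 0" "T x = \<mu> *\<^sub>R x" "c \<le> \<mu>"
    using self_adjoint_eigenvector_ge[OF rlin sa W inv, of z c] z by (auto simp: W_def)
  have we: "w \<in> eigenspace T t" and xe: "x \<in> eigenspace T \<mu>"
    using top(1) x(3) by (auto simp: eigenspace_def of_real_vector_mult)
  have S: "t \<in> S" "\<mu> \<in> S" using we xe top(2) x(2) by (auto simp: S_def)
  have le: "\<mu> \<le> t" using max[of x \<mu>] x by (simp add: of_real_vector_mult)
  have pos: "vec.dim (eigenspace T s) \<ge> 1" if "y \<in> eigenspace T s" "y \<noteq> 0" for s y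
    using vec.independent_card_le_dim[of "{y}" "eigenspace T s"] that
    by (simp add: vec.dependent_single)
  have sub: "{#t, \<mu>#} \<subseteq># eigenvalues T"
  proof (cases "\<mu> = t")
    case True
    have "w \<noteq> x" using x(1) top(2) by (auto simp: W_def)
    \<comment> \<open>A repeated eigenvalue is counted by the complex dimension of its eigenspace,
      so independence is needed over the complex numbers.\<close>
    have ind: "vec.independent {w, x}"
    proof -
      have "w \<notin> vec.span {x}"
      proof
        assume "w \<in> vec.span {x}"
        then obtain k where k: "w = k *s x" by (auto simp: vec.span_singleton)
        have 1: "x \<bullet> w = 0" "x \<bullet> (\<i> *s w) = 0" using x(1) by (auto simp: W_def)
        have "w = Re k *\<^sub>R x + Im k *\<^sub>R (\<i> *s x)"
          unfolding k by (simp add: vec_eq_iff complex_eq_iff)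
        then have "w \<bullet> w = Re k * (x \<bullet> w) + Im k * ((\<i> *s x) \<bullet> w)"
          by (metis inner_add_left inner_scaleR_left)
        also have "\<dots> = 0" using 1 by (simp add: inner_i_mult_left)
        finally show False using top(2) by simp
      qed
      then show ?thesis
        using x(2) \<open>w \<noteq> x\<close> by (simp add: vec.independent_insert)
    qed
    have "card {w, x} \<le> vec.dim (eigenspace T t)"
      using vec.independent_card_le_dim[OF _ ind] we xe True by simp
    then have "2 \<le> count (eigenvalues T) t"
      using \<open>w \<noteq> x\<close> S(1) by (simp add: count)
    then show ?thesis using True by (simp add: subseteq_mset_def)
  next
    case False
    then show ?thesis
      using pos[OF we top(2)] pos[OF xe x(2)] S by (auto simp: subseteq_mset_def count)
  qed
  then have "eigenvalues T \<noteq> {#}" by auto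
  then show "eigval 1 T \<le> t"
    using rev_sorted_nth_0_le[of "eigenvalues T" t] mem by (simp add: eigval_def)
  show "c \<le> eigval 2 T"
    using rev_sorted_nth_1_ge[OF sub le] x(4) by (simp add: eigval_def)
qed

section \<open>Test functions on the skeleton\<close>

lemma sum_sqrt_mult_le:
  assumes "\<And>i. i \<in> I \<Longrightarrow> 0 \<le> x i" "\<And>i. i \<in> I \<Longrightarrow> 0 \<le> y i"
  shows "(\<Sum>i\<in>I. sqrt (x i) * sqrt (y i)) \<le> sqrt (\<Sum>i\<in>I. x i) * sqrt (\<Sum>i\<in>I. y i)"
  using L2_set_mult_ineq[of "\<lambda>i. sqrt (x i)" "\<lambda>i. sqrt (y i)" I] assms
  by (simp add: L2_set_def cong: sum.cong)

lemma sqrt_mult_add_le: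
  assumes "0 \<le> a" "0 \<le> b" "0 \<le> c" "0 \<le> d"
  shows "sqrt a * sqrt b + sqrt c * sqrt d \<le> sqrt (a + c) * sqrt (b + d)"
  using sum_sqrt_mult_le[of UNIV "\<lambda>s. if s then a else c" "\<lambda>s. if s then b else d"] assms
  by (simp add: UNIV_bool add_ac)

text \<open>The partial sums satisfy s_{n+1} = 1 - s_n / D, a map that preserves the interval
  [0, 1].\<close>

lemma alternating_sum_bounds:
  fixes D :: real
  assumes "1 \<le> D"
  shows "0 \<le> (\<Sum>k<n. (-1) ^ k / D ^ k)" and "(\<Sum>k<n. (-1) ^ k / D ^ k) \<le> 1"
proof -
  have "0 \<le> (\<Sum>k<n. (-1) ^ k / D ^ k) \<and> (\<Sum>k<n. (-1) ^ k / D ^ k) \<le> 1"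
  proof (induction n)
    case (Suc n)
    let ?s = "\<Sum>k<n. (-1) ^ k / D ^ k"
    have "(\<Sum>k<Suc n. (-1) ^ k / D ^ k) = 1 - ?s / D"
      unfolding sum.lessThan_Suc_shift by (simp add: sum_divide_distrib sum_negf mult.commute)
    moreover have "?s / D \<le> 1" "0 \<le> ?s / D" using Suc assms by (auto simp: divide_simps)
    ultimately show ?case by simp
  qed simp
  then show "0 \<le> (\<Sum>k<n. (-1) ^ k / D ^ k)" "(\<Sum>k<n. (-1) ^ k / D ^ k) \<le> 1" by auto
qed

section \<open>Walks, and steps in the skeleton\<close>

lemma walk_append: "walk G x es y \<Longrightarrow> walk G y fs z \<Longrightarrow> walk G x (es @ fs) z"
  by (induction G x es y rule: walk.induct) auto

lemma walk_reverse: "walk G x es y \<Longrightarrow> \<exists>fs. walk G y fs x \<and> length fs = length es"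
proof (induction G x es y rule: walk.induct)
  case (2 G x e s es y)
  then obtain fs where "walk G y fs (if s then tgt G e else src G e)" "length fs = length es"
    by auto
  moreover have "walk G (if s then tgt G e else src G e) [(e, \<not> s)] x"
    using 2(2) by auto
  ultimately show ?case
    by (intro exI[of _ "fs @ [(e, \<not> s)]"]) (auto intro: walk_append)
qed auto

text \<open>A label \<open>(i, s)\<close> is a direction out of a skeleton vertex, along the edge of
  type \<open>i\<close> if \<open>s\<close> holds and against it otherwise.\<close>

definition opp :: "nat \<times> bool \<Rightarrow> nat \<times> bool" where
  "opp c = (fst c, \<not> snd c)"

definition step :: "(nat \<Rightarrow> 'u \<Rightarrow> 'u) \<Rightarrow> nat \<times> bool \<Rightarrow> 'u \<Rightarrow> 'u" where
  "step shift c = (if snd c then shift (fst c) else inv (shift (fst c)))"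

lemma opp_opp [simp]: "opp (opp c) = c" and fst_opp [simp]: "fst (opp c) = fst c"
  by (auto simp: opp_def)

text \<open>The tree is rooted at an edge, the one between \<open>u0\<close> and
  \<open>shift j u0\<close>, whose two ends form layer 0. The tree itself is not constructed: only
  the numbers of its vertices above each skeleton vertex enter.\<close>

locale rooted_skeleton =
  fixes shift :: "nat \<Rightarrow> 'u::finite \<Rightarrow> 'u" and l :: nat and u0 :: 'u and j :: nat
  assumes bij_shift: "\<And>i. i \<in> {1..l} \<Longrightarrow> bij (shift i)" and j: "j \<in> {1..l}"
begin

definition labels :: "(nat \<times> bool) set" where
  "labels = {1..l} \<times> UNIV"

text \<open>
  The number of vertices above \<open>u\<close> in layer \<open>k\<close> of the tree whose parent edge is labelled \<open>c\<close>, that is,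
  of non-backtracking walks that begin by traversing the edge between \<open>u0\<close> and \<open>shift j u0\<close> in
  either direction, make \<open>k\<close> more steps and end at \<open>u\<close> with a step labelled \<open>c\<close>.
\<close>

primrec nbw :: "nat \<Rightarrow> nat \<times> bool \<Rightarrow> 'u \<Rightarrow> real" where
  "nbw 0 c u = (if c = (j, True) \<and> u = shift j u0 \<or> c = (j, False) \<and> u = u0 then 1 else 0)"
| "nbw (Suc k) c u = (\<Sum>c'\<in>labels - {opp c}. nbw k c' (step shift (opp c) u))"

definition tot :: "nat \<Rightarrow> 'u \<Rightarrow> real" where
  "tot k u = (\<Sum>c\<in>labels. nbw k c u)"

text \<open>The weight w_k of the tree edges from layer \<open>k\<close> to the parents; for
  \<open>k = 0\<close> it counts the root edge once from each end. For the constant 1 it is the size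
  of layer \<open>k\<close>.\<close>

definition weight :: "(nat \<Rightarrow> real) \<Rightarrow> nat \<Rightarrow> real" where
  "weight \<alpha> k = (\<Sum>c\<in>labels. \<alpha> (fst c) * (\<Sum>u\<in>UNIV. nbw k c u))"

text \<open>The radial function pushed down to the skeleton: a tree vertex in layer
  \<open>k < n\<close> contributes (d-1)^{-k}, the square of the radial value, under the
  root.\<close>

definition test_fun :: "nat \<Rightarrow> 'u \<Rightarrow> real" where
  "test_fun n u = sqrt (\<Sum>k<n. tot k u / (2 * real l - 1) ^ k)"

section \<open>Layers of the tree and their weights\<close>

lemma finite_labels [simp]: "finite labels" by (simp add: labels_def)

lemma opp_labels [simp]: "opp c \<in> labels \<longleftrightarrow> c \<in> labels"
  by (cases c) (auto simp: labels_def opp_def)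

lemma bij_opp: "bij_betw opp labels labels"
  by (rule bij_betwI[of _ _ _ opp]) auto

lemma bij_step: "c \<in> labels \<Longrightarrow> bij (step shift c)"
  using bij_shift by (auto simp: labels_def step_def bij_imp_bij_inv)

lemma step_opp: "c \<in> labels \<Longrightarrow> step shift (opp c) (step shift c u) = u"
  using bij_shift[of "fst c"]
  by (auto simp: labels_def step_def opp_def bij_is_inj bij_is_surj surj_f_inv_f)

lemma degree_ge_1: "1 \<le> 2 * real l - 1" using j by auto

lemma nbw_nonneg: "0 \<le> nbw k c u"
  by (induction k arbitrary: c u) (auto intro: sum_nonneg)

lemma tot_nonneg: "0 \<le> tot k u"
  by (simp add: tot_def sum_nonneg nbw_nonneg)

text \<open>Both sides indicate whether the step \<open>c\<close> from \<open>u\<close> traverses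
  the root edge.\<close>

lemma nbw_0_opp: "c \<in> labels \<Longrightarrow> nbw 0 c (step shift c u) = nbw 0 (opp c) u"
  using bij_inv_eq_iff[OF bij_shift[OF j]] bij_is_inj[OF bij_shift[OF j], THEN inj_eq]
  by (cases c; cases "snd c") (auto simp: step_def opp_def)

text \<open>At a tree vertex above \<open>u\<close>, the edge in direction \<open>c\<close> leads
  either to the parent, and then the parent edge is labelled \<open>opp c\<close>, or to a child
  above \<open>step shift c u\<close>.\<close>

lemma tot_split:
  assumes "c \<in> labels"
  shows "tot k u = nbw k (opp c) u + nbw (Suc k) c (step shift c u)"
  using assms by (simp add: tot_def step_opp sum.remove[of labels "opp c"])

lemma weight_0: "weight \<alpha> 0 = 2 * \<alpha> j"
proof -
  have s: "(\<Sum>u\<in>UNIV. nbw 0 c u) = (if c = (j, True) \<or> c = (j, False) then 1 else 0)" for c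
    by (cases "c = (j, True)"; cases "c = (j, False)") auto
  have "weight \<alpha> 0 = (\<Sum>c\<in>{(j, True), (j, False)}. \<alpha> (fst c))"
    unfolding weight_def s using j by (intro sum.mono_neutral_cong_right) (auto simp: labels_def)
  then show ?thesis by simp
qed

lemma sum_step: "c \<in> labels \<Longrightarrow> (\<Sum>u\<in>UNIV. h (step shift c u)) = (\<Sum>u\<in>UNIV. h u)"
  by (rule sum.reindex_bij_betw[OF bij_step])

lemma sum_opp: "(\<Sum>c\<in>labels. h (opp c)) = (\<Sum>c\<in>labels. h c)"
  by (rule sum.reindex_bij_betw[OF bij_opp])

lemma sum_tot: "(\<Sum>u\<in>UNIV. tot k u) = weight (\<lambda>_. 1) k"
  unfolding tot_def weight_def by (simp add: sum.swap[of _ labels])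

lemma sum_labels: "(\<Sum>c\<in>labels. \<alpha> (fst c)) = 2 * (\<Sum>i\<in>{1..l}. \<alpha> i :: real)"
  unfolding labels_def by (simp add: sum.cartesian_product[symmetric] case_prod_beta' sum_distrib_left
      sum.cartesian_product' UNIV_bool)

text \<open>Each vertex of layer \<open>k\<close> has one edge for each label, of total weight
  \<open>2 * (\<Sum>i\<in>{1..l}. \<alpha> i)\<close>. Of these, the parent edges make up
  \<open>weight \<alpha> k\<close> and the child edges
  \<open>weight \<alpha> (Suc k)\<close>.\<close>

lemma weight_Suc:
  "weight \<alpha> (Suc k) = 2 * (\<Sum>i\<in>{1..l}. \<alpha> i) * weight (\<lambda>_. 1) k - weight \<alpha> k"
proof -
  have "(\<Sum>u\<in>UNIV. nbw (Suc k) c u) = weight (\<lambda>_. 1) k - (\<Sum>u\<in>UNIV. nbw k (opp c) u)"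
    if "c \<in> labels" for c
  proof -
    have "(\<Sum>u\<in>UNIV. nbw (Suc k) c u) = (\<Sum>u\<in>UNIV. nbw (Suc k) c (step shift c u))"
      by (rule sum_step[OF that, symmetric])
    also have "\<dots> = (\<Sum>u\<in>UNIV. tot k u - nbw k (opp c) u)"
      by (rule sum.cong) (simp_all only: tot_split[OF that] add_diff_cancel_left')
    finally show ?thesis by (simp add: sum_subtractf sum_tot)
  qed
  then have "weight \<alpha> (Suc k)
     = (\<Sum>c\<in>labels. \<alpha> (fst c) * (weight (\<lambda>_. 1) k - (\<Sum>u\<in>UNIV. nbw k (opp c) u)))"
    unfolding weight_def[of \<alpha> "Suc k"] by (intro sum.cong) auto
  also have "\<dots> = (\<Sum>c\<in>labels. \<alpha> (fst c)) * weight (\<lambda>_. 1) k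
      - (\<Sum>c\<in>labels. \<alpha> (fst (opp c)) * (\<Sum>u\<in>UNIV. nbw k (opp c) u))"
    by (simp add: right_diff_distrib sum_subtractf sum_distrib_right)
  also have "\<dots> = (\<Sum>c\<in>labels. \<alpha> (fst c)) * weight (\<lambda>_. 1) k - weight \<alpha> k"
    unfolding sum_opp[of "\<lambda>c. \<alpha> (fst c) * (\<Sum>u\<in>UNIV. nbw k c u)"] weight_def by simp
  finally show ?thesis by (simp only: sum_labels)
qed

lemma weight_1: "weight (\<lambda>_. 1) k = 2 * (2 * real l - 1) ^ k"
  by (induction k) (simp_all add: weight_0 weight_Suc algebra_simps)

text \<open>The first term, with \<open>s\<close> the mean of the \<open>\<alpha> i\<close>, is a
  particular solution of the recursion. The deviation from it changes sign from layer to layer and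
  starts with \<open>2 * (\<alpha> j - s)\<close>.\<close>

lemma weight_eq:
  assumes "s * real l = (\<Sum>i\<in>{1..l}. \<alpha> i)"
  shows "weight \<alpha> k = 2 * s * (2 * real l - 1) ^ k + 2 * (\<alpha> j - s) * (-1) ^ k"
proof (induction k)
  case (Suc k)
  show ?case unfolding weight_Suc weight_1 assms[symmetric] Suc by (simp add: algebra_simps)
qed (simp add: weight_0)

section \<open>Norm and energy of the test functions\<close>

lemma test_fun_nonneg: "0 \<le> test_fun n u"
  using degree_ge_1 by (auto simp: test_fun_def intro!: sum_nonneg divide_nonneg_nonneg tot_nonneg)

lemma test_fun_sq: "(test_fun n u)\<^sup>2 = (\<Sum>k<n. tot k u / (2 * real l - 1) ^ k)"
  unfolding test_fun_def using degree_ge_1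
  by (intro real_sqrt_pow2 sum_nonneg divide_nonneg_nonneg tot_nonneg) auto

lemma sum_test_fun_sq: "(\<Sum>u\<in>UNIV. (test_fun n u)\<^sup>2) = 2 * real n"
proof -
  have "(\<Sum>u\<in>UNIV. (test_fun n u)\<^sup>2)
      = (\<Sum>k<n. (\<Sum>u\<in>UNIV. tot k u) / (2 * real l - 1) ^ k)"
    unfolding test_fun_sq by (subst sum.swap) (simp add: sum_divide_distrib)
  then show ?thesis
    using degree_ge_1 unfolding sum_tot weight_1 by (simp cong: sum.cong)
qed

text \<open>The tree vertices above \<open>u\<close> are sorted by their edge in direction
  \<open>c\<close>: the root edge, an edge to a child in layer \<open>k + 1\<close> (counted by
  \<open>X k\<close>), or an edge from layer \<open>k + 1\<close> to a parent (counted by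
  \<open>Y k\<close>). Only the vertices of the last layer \<open>n\<close> whose edge leads to a
  child are dropped.\<close>

lemma test_fun_ge:
  fixes u :: 'u
  assumes "c \<in> labels"
  defines "X k \<equiv> nbw (Suc k) c (step shift c u)" and "Y k \<equiv> nbw (Suc k) (opp c) u"
  shows "sqrt (nbw 0 (opp c) u + ((\<Sum>k<n. X k / (2 * real l - 1) ^ k)
     + (\<Sum>k<n. Y k / (2 * real l - 1) ^ Suc k))) \<le> test_fun (Suc n) u"
proof -
  let ?D = "2 * real l - 1"
  have "(\<Sum>k<Suc n. tot k u / ?D ^ k)
      = (\<Sum>k<Suc n. nbw k (opp c) u / ?D ^ k) + (\<Sum>k<Suc n. X k / ?D ^ k)"
    unfolding tot_split[OF assms(1)] X_def by (simp only: add_divide_distrib sum.distrib)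
  also have "(\<Sum>k<Suc n. nbw k (opp c) u / ?D ^ k) = nbw 0 (opp c) u + (\<Sum>k<n. Y k / ?D ^ Suc k)"
    unfolding sum.lessThan_Suc_shift Y_def by (simp del: nbw.simps)
  finally have "(\<Sum>k<Suc n. tot k u / ?D ^ k) = nbw 0 (opp c) u + (\<Sum>k<n. Y k / ?D ^ Suc k)
      + ((\<Sum>k<n. X k / ?D ^ k) + X n / ?D ^ n)" by simp
  moreover have "0 \<le> X n / ?D ^ n" unfolding X_def
    using degree_ge_1 by (intro divide_nonneg_nonneg nbw_nonneg) auto
  ultimately show ?thesis unfolding test_fun_def by (intro real_sqrt_le_mono) linarith
qed

text \<open>Cauchy-Schwarz over the tree edges above the skeleton edge from \<open>u\<close> to
  \<open>step shift c u\<close>. The root edge contributes 1, and an edge between layers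
  \<open>k\<close> and \<open>k + 1\<close> contributes the product of the radial values at its
  ends.\<close>

lemma test_fun_mult_ge:
  fixes u :: 'u
  assumes c: "c \<in> labels"
  defines "X k \<equiv> nbw (Suc k) c (step shift c u)" and "Y k \<equiv> nbw (Suc k) (opp c) u"
  shows "nbw 0 (opp c) u + (\<Sum>k<n. (X k + Y k) / (sqrt (2 * real l - 1) * (2 * real l - 1) ^ k))
     \<le> test_fun (Suc n) u * test_fun (Suc n) (step shift c u)"
proof -
  let ?D = "2 * real l - 1"
  have D: "?D > 0" using degree_ge_1 by linarith
  have nn: "0 \<le> X k / ?D ^ m" "0 \<le> Y k / ?D ^ m" "0 \<le> nbw 0 (opp c) u" for k m
    unfolding X_def Y_def using D by (auto intro!: divide_nonneg_nonneg nbw_nonneg simp del: nbw.simps)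
  have g: "sqrt (x / ?D ^ k) * sqrt (x / ?D ^ Suc k) = x / (sqrt ?D * ?D ^ k)" if "0 \<le> x" for x k
  proof -
    have "sqrt (x / ?D ^ k) * sqrt (x / ?D ^ Suc k) = sqrt ((x / ?D ^ k)\<^sup>2 / ?D)"
      by (simp add: real_sqrt_mult[symmetric] power2_eq_square)
    also have "\<dots> = (x / ?D ^ k) / sqrt ?D"
      using that D by (simp add: real_sqrt_divide)
    finally show ?thesis by (simp add: mult.commute)
  qed
  have xy: "0 \<le> X k" "0 \<le> Y k" for k by (simp_all add: X_def Y_def nbw_nonneg del: nbw.simps)
  have sp: "step shift (opp c) (step shift c u) = u" using step_opp[OF c] .
  have z: "nbw 0 c (step shift c u) = nbw 0 (opp c) u" by (rule nbw_0_opp[OF c])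
  let ?X = "\<Sum>k<n. X k / ?D ^ k" and ?X' = "\<Sum>k<n. X k / ?D ^ Suc k"
  let ?Y = "\<Sum>k<n. Y k / ?D ^ k" and ?Y' = "\<Sum>k<n. Y k / ?D ^ Suc k"
  let ?z = "nbw 0 (opp c) u"
  have sn: "0 \<le> ?X" "0 \<le> ?X'" "0 \<le> ?Y" "0 \<le> ?Y'" by (auto intro!: sum_nonneg nn simp del: power_Suc)
  have "?z + (\<Sum>k<n. (X k + Y k) / (sqrt ?D * ?D ^ k))
     = sqrt ?z * sqrt ?z + ((\<Sum>k<n. sqrt (X k / ?D ^ k) * sqrt (X k / ?D ^ Suc k))
        + (\<Sum>k<n. sqrt (Y k / ?D ^ Suc k) * sqrt (Y k / ?D ^ k)))"
    using nn(3) by (simp only: g xy mult.commute[of "sqrt (Y _ / ?D ^ Suc _)"] add_divide_distrib sum.distrib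
        real_sqrt_mult_self abs_of_nonneg)
  also have "\<dots> \<le> sqrt ?z * sqrt ?z + (sqrt ?X * sqrt ?X' + sqrt ?Y' * sqrt ?Y)"
    by (intro add_mono order_refl sum_sqrt_mult_le nn)
  also have "\<dots> \<le> sqrt ?z * sqrt ?z + sqrt (?X + ?Y') * sqrt (?X' + ?Y)"
    by (intro add_mono order_refl sqrt_mult_add_le sn)
  also have "\<dots> \<le> sqrt (?z + (?X + ?Y')) * sqrt (?z + (?X' + ?Y))"
    by (intro sqrt_mult_add_le add_nonneg_nonneg sn nn(3))
  also have "\<dots> \<le> test_fun (Suc n) u * test_fun (Suc n) (step shift c u)"
  proof (rule mult_mono)
    show "sqrt (?z + (?X + ?Y')) \<le> test_fun (Suc n) u"
      using test_fun_ge[OF c, where u = u and n = n] by (simp only: X_def Y_def)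
    \<comment> \<open>Seen from the other end, in direction \<open>opp c\<close>, the roles of
      \<open>X\<close> and \<open>Y\<close> are exchanged.\<close>
    have "sqrt (?z + (?Y + ?X')) \<le> test_fun (Suc n) (step shift c u)"
      using test_fun_ge[where c = "opp c" and n = n and u = "step shift c u"] c
      by (simp only: X_def Y_def opp_labels opp_opp z sp)
    then show "sqrt (?z + (?X' + ?Y)) \<le> test_fun (Suc n) (step shift c u)"
      by (simp only: add.commute[of ?X' ?Y])
  qed (auto intro!: test_fun_nonneg add_nonneg_nonneg sn nn(3) simp del: power_Suc nbw.simps)
  finally show ?thesis .
qed

text \<open>Summing the edge estimate over all \<open>u\<close> and \<open>c\<close> leaves only
  layer weights, which are known explicitly: every layer below the last adds
  \<open>4 * q * s\<close> up to an alternating error.\<close>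

lemma test_fun_energy:
  assumes \<alpha>: "\<And>i. i \<in> {1..l} \<Longrightarrow> 0 \<le> \<alpha> i" and s: "s * real l = (\<Sum>i\<in>{1..l}. \<alpha> i)" and n: "1 \<le> n"
  defines "q \<equiv> sqrt (2 * real l - 1)"
  shows "2 * real n * (2 * q * s - ((2 * q - 1) * s + \<bar>s - \<alpha> j\<bar>) / real n)
     \<le> (\<Sum>c\<in>labels. \<alpha> (fst c) * (\<Sum>u\<in>UNIV. test_fun n u * test_fun n (step shift c u)))"
proof -
  obtain m where m: "n = Suc m" using n by (cases n) auto
  let ?D = "2 * real l - 1"
  have D: "?D \<ge> 1" by (rule degree_ge_1)
  have q: "q \<ge> 1" "q * q = ?D" using D by (auto simp: q_def)
  \<comment> \<open>The accumulated alternating error; the argument uses only that it lies in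
    [0, 1].\<close>
  define t where "t = (\<Sum>k<m. (-1) ^ k / ?D ^ k) / q"
  have t: "0 \<le> t" "t \<le> 1"
    using alternating_sum_bounds[OF D, of m] q by (auto simp: t_def divide_simps)
  have X: "(\<Sum>c\<in>labels. \<alpha> (fst c) * (\<Sum>u\<in>UNIV. nbw k c (step shift c u))) = weight \<alpha> k" for k
    unfolding weight_def by (intro sum.cong refl arg_cong2[where f = "(*)"] sum_step)
  have Y: "(\<Sum>c\<in>labels. \<alpha> (fst c) * (\<Sum>u\<in>UNIV. nbw k (opp c) u)) = weight \<alpha> k" for k
    using sum_opp[of "\<lambda>c. \<alpha> (fst c) * (\<Sum>u\<in>UNIV. nbw k c u)"] by (simp add: weight_def)
  have "2 * real n * (2 * q * s - ((2 * q - 1) * s + \<bar>s - \<alpha> j\<bar>) / real n)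
      = 4 * real m * q * s + 2 * s - 2 * \<bar>s - \<alpha> j\<bar>"
  proof -
    have *: "2 * real n * (x - y / real n) = 2 * real n * x - 2 * y" for x y
      using n by (simp add: field_simps)
    show ?thesis unfolding * by (simp add: m algebra_simps)
  qed
  also have "\<dots> \<le> 4 * real m * q * s + 2 * \<alpha> j - 4 * (\<alpha> j - s) * t"
  \<comment> \<open>The two sides differ by twice
    \<open>\<bar>s - \<alpha> j\<bar> - (s - \<alpha> j) * (1 - 2 * t)\<close>, and 1 - 2t lies in
    [-1, 1].\<close>
  proof -
    have "(s - \<alpha> j) * (1 - 2 * t) \<le> \<bar>(s - \<alpha> j) * (1 - 2 * t)\<bar>" by simp
    also have "\<dots> \<le> \<bar>s - \<alpha> j\<bar> * 1"
      unfolding abs_mult using t by (intro mult_left_mono) auto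
    finally show ?thesis by (simp add: algebra_simps)
  qed
  also have "\<dots> = weight \<alpha> 0 + (\<Sum>k<m. 2 * weight \<alpha> (Suc k) / (q * ?D ^ k))"
  proof -
    have "2 * weight \<alpha> (Suc k) / (q * ?D ^ k) = 4 * q * s - 4 * (\<alpha> j - s) * ((-1) ^ k / ?D ^ k / q)" for k
    proof -
      have "2 * weight \<alpha> (Suc k) = 4 * s * (q * q) * ?D ^ k - 4 * (\<alpha> j - s) * (-1) ^ k"
        unfolding weight_eq[OF s] q(2) by (simp add: algebra_simps)
      moreover have "?D ^ k \<noteq> 0" "q \<noteq> 0" using D q by auto
      ultimately show ?thesis by (simp add: field_simps)
    qed
    then have "(\<Sum>k<m. 2 * weight \<alpha> (Suc k) / (q * ?D ^ k)) = 4 * real m * q * s - 4 * (\<alpha> j - s) * t"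
      by (simp add: sum_subtractf sum_distrib_left t_def sum_divide_distrib)
    then show ?thesis by (simp add: weight_0)
  qed
  \<comment> \<open>The factor 2 is used up here: every non-root tree edge is counted from both
    ends, as a child edge and as a parent edge.\<close>
  also have "\<dots> = (\<Sum>c\<in>labels. \<alpha> (fst c) * (\<Sum>u\<in>UNIV. nbw 0 (opp c) u))
     + (\<Sum>k<m. ((\<Sum>c\<in>labels. \<alpha> (fst c) * (\<Sum>u\<in>UNIV. nbw (Suc k) c (step shift c u)))
       + (\<Sum>c\<in>labels. \<alpha> (fst c) * (\<Sum>u\<in>UNIV. nbw (Suc k) (opp c) u))) / (q * ?D ^ k))"
    unfolding X Y by simp
  also have "\<dots> = (\<Sum>c\<in>labels. \<alpha> (fst c) * (\<Sum>u\<in>UNIV. nbw 0 (opp c) u +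
     (\<Sum>k<m. (nbw (Suc k) c (step shift c u) + nbw (Suc k) (opp c) u) / (q * ?D ^ k))))"
    by (simp only: sum.distrib distrib_left sum_distrib_left add_divide_distrib sum_divide_distrib
        times_divide_eq_right sum.swap[of _ _ "{..<m}"])
  also have "\<dots> \<le> (\<Sum>c\<in>labels. \<alpha> (fst c) * (\<Sum>u\<in>UNIV. test_fun n u * test_fun n (step shift c u)))"
    unfolding m q_def using \<alpha>
    by (intro sum_mono mult_left_mono test_fun_mult_ge) (auto simp: labels_def)
  finally show ?thesis .
qed

section \<open>Supports of the test functions\<close>

lemma walk_step:
  assumes "c \<in> labels"
  shows "\<exists>es. walk (skeleton l shift) u es (step shift c u) \<and> length es = 1"
proof -
  have "walk (skeleton l shift) u [if snd c then ((u, fst c), True)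
      else ((step shift c u, fst c), False)] (step shift c u)"
    using assms step_opp[OF assms, of u] by (auto simp: skeleton_def step_def labels_def opp_def)
  then show ?thesis by (metis One_nat_def length_Cons list.size(3))
qed

lemma nbw_walk:
  assumes "nbw k c u \<noteq> 0" "c \<in> labels"
  shows "\<exists>x\<in>{u0, shift j u0}. \<exists>es. walk (skeleton l shift) x es u \<and> length es = k"
  using assms
proof (induction k arbitrary: c u)
  case 0
  then have "u \<in> {u0, shift j u0}" by (auto split: if_splits)
  then show ?case by (metis list.size(3) walk.simps(1))
next
  case (Suc k)
  define v where "v = step shift (opp c) u"
  obtain c' where "c' \<in> labels" "nbw k c' v \<noteq> 0"
    using Suc.prems(1) unfolding v_def nbw.simps
    by (elim sum.not_neutral_contains_not_neutral) blast
  then obtain x es where x: "x \<in> {u0, shift j u0}" "walk (skeleton l shift) x es v" "length es = k"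
    using Suc.IH by blast
  moreover obtain fs where "walk (skeleton l shift) v fs u" "length fs = 1"
    using walk_step[OF Suc.prems(2), of v] step_opp[of "opp c" u] Suc.prems(2) by (auto simp: v_def)
  ultimately have "walk (skeleton l shift) x (es @ fs) u" "length (es @ fs) = Suc k"
    by (auto intro: walk_append)
  then show ?case using x(1) by blast
qed

lemma test_fun_walk:
  assumes "test_fun n u \<noteq> 0"
  shows "\<exists>x\<in>{u0, shift j u0}. \<exists>es. walk (skeleton l shift) x es u \<and> length es < n"
proof -
  have "(\<Sum>k<n. tot k u / (2 * real l - 1) ^ k) \<noteq> 0"
    using assms by (auto simp: test_fun_def)
  then obtain k where k: "k < n" "tot k u \<noteq> 0"
    by (auto elim!: sum.not_neutral_contains_not_neutral)
  then obtain c where "c \<in> labels" "nbw k c u \<noteq> 0"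
    unfolding tot_def by (auto elim!: sum.not_neutral_contains_not_neutral)
  then show ?thesis using nbw_walk k(1) by metis
qed

end

text \<open>Supports reach at most \<open>n - 1\<close> steps from their root edges, so a connection
  of length at most 1 between them would bring the root edges too close. Length 0 gives
  disjointness, length 1 that no edge joins the supports.\<close>

lemma far_test_funs:
  assumes "rooted_skeleton shift l j1" "rooted_skeleton shift l j2"
    and far: "\<forall>x1\<in>{u1, shift j1 u1}. \<forall>x2\<in>{u2, shift j2 u2}. gdist (skeleton l shift) x1 x2 > enat (2 * n)"
    and nz: "rooted_skeleton.test_fun shift l u1 j1 n v1 \<noteq> 0" "rooted_skeleton.test_fun shift l u2 j2 n v2 \<noteq> 0"
    and es: "walk (skeleton l shift) v1 es v2" "length es \<le> 1"
  shows False
proof -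
  interpret R1: rooted_skeleton shift l u1 j1 by fact
  interpret R2: rooted_skeleton shift l u2 j2 by fact
  obtain x1 es1 where 1: "x1 \<in> {u1, shift j1 u1}" "walk (skeleton l shift) x1 es1 v1" "length es1 < n"
    using R1.test_fun_walk[OF nz(1)] by blast
  obtain x2 es2 where 2: "x2 \<in> {u2, shift j2 u2}" "walk (skeleton l shift) x2 es2 v2" "length es2 < n"
    using R2.test_fun_walk[OF nz(2)] by blast
  obtain fs2 where 3: "walk (skeleton l shift) v2 fs2 x2" "length fs2 = length es2"
    using walk_reverse[OF 2(2)] by blast
  have "walk (skeleton l shift) x1 (es1 @ es @ fs2) x2"
    by (rule walk_append[OF 1(2) walk_append[OF es(1) 3(1)]])
  then have "gdist (skeleton l shift) x1 x2 \<le> enat (length (es1 @ es @ fs2))"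
    unfolding gdist_def by (intro INF_lower CollectI)
  also have "\<dots> \<le> enat (2 * n)" using 1(3) 2(3) 3(2) es(2) by simp
  finally have "\<not> enat (2 * n) < gdist (skeleton l shift) x1 x2" by (rule leD)
  then show False using bspec[OF bspec[OF far 1(1)] 2(1)] by (rule notE)
qed

text \<open>The root labels \<open>j1\<close> and \<open>j2\<close> may differ; the common value
  \<open>t\<close> of their weights makes both energy bounds the same.\<close>

lemma two_test_funs:
  assumes R: "rooted_skeleton shift l j1" "rooted_skeleton shift l j2"
    and far: "\<forall>x1\<in>{u1, shift j1 u1}. \<forall>x2\<in>{u2, shift j2 u2}. gdist (skeleton l shift) x1 x2 > enat (2 * n)"
    and \<alpha>: "\<And>i. i \<in> {1..l} \<Longrightarrow> 0 \<le> \<alpha> i" "\<alpha> j1 = t" "\<alpha> j2 = t"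
    and s: "s * real l = (\<Sum>i\<in>{1..l}. \<alpha> i)" and n: "1 \<le> n"
  defines "q \<equiv> sqrt (2 * real l - 1)"
  obtains f :: "'u::finite \<Rightarrow> real" where "(\<Sum>u\<in>UNIV. f u) = 0" "0 < (\<Sum>u\<in>UNIV. (f u)\<^sup>2)"
    "(2 * q * s - ((2 * q - 1) * s + \<bar>s - t\<bar>) / real n) * (\<Sum>u\<in>UNIV. (f u)\<^sup>2)
     \<le> (\<Sum>u\<in>UNIV. f u * (\<Sum>i\<in>{1..l}. \<alpha> i * (f (shift i u) + f (inv (shift i) u))))"
proof -
  interpret R1: rooted_skeleton shift l u1 j1 by (rule R)
  interpret R2: rooted_skeleton shift l u2 j2 by (rule R)
  define \<theta> where "\<theta> = 2 * q * s - ((2 * q - 1) * s + \<bar>s - t\<bar>) / real n"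
  let ?F = "R1.test_fun n" and ?G = "R2.test_fun n"
  define E where "E f g = (\<Sum>c\<in>R1.labels. \<alpha> (fst c) * (\<Sum>u\<in>UNIV. f u * g (step shift c u)))"
    for f g :: "'u \<Rightarrow> real"
  have E: "2 * real n * \<theta> \<le> E ?F ?F" "2 * real n * \<theta> \<le> E ?G ?G"
    using R1.test_fun_energy[OF \<alpha>(1) s n] R2.test_fun_energy[OF \<alpha>(1) s n] \<alpha>(2,3)
    unfolding E_def \<theta>_def q_def by simp_all
  have disj: "?F u * ?G u = 0" for u
    using far_test_funs[OF R far, of u u "[]"] by auto
  have cross: "?F u * ?G (step shift c u) = 0" "?G u * ?F (step shift c u) = 0" if c: "c \<in> R1.labels" for c u
  proof -
    obtain es where "walk (skeleton l shift) u es (step shift c u)" "length es = 1"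
      using R1.walk_step[OF c] by blast
    then show "?F u * ?G (step shift c u) = 0"
      using far_test_funs[OF R far, of u "step shift c u" es] by auto
    have "opp c \<in> R1.labels" using c by simp
    from R1.walk_step[OF this, of "step shift c u"]
    obtain es where "walk (skeleton l shift) (step shift c u) es u" "length es = 1"
      using R1.step_opp[OF c] by auto
    then show "?G u * ?F (step shift c u) = 0"
      using far_test_funs[OF R far, of "step shift c u" u es] by auto
  qed
  define x where "x = (\<Sum>u\<in>UNIV. ?F u)"
  define y where "y = (\<Sum>u\<in>UNIV. ?G u)"
  \<comment> \<open>This keeps the combination \<open>f\<close> below from vanishing.\<close>
  have xy: "x \<noteq> 0"
  proof
    assume "x = 0"
    then have "?F u = 0" for u
      unfolding x_def by (subst (asm) sum_nonneg_eq_0_iff) (auto simp: R1.test_fun_nonneg)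
    then show False using R1.sum_test_fun_sq[of n] n by simp
  qed
  \<comment> \<open>The coefficients are the total masses of the opposite functions, so that
    \<open>f\<close> has sum 0. All mixed terms vanish because the supports are disjoint and not
    adjacent.\<close>
  define f where "f u = y * ?F u - x * ?G u" for u
  have "(\<Sum>u\<in>UNIV. f u) = 0"
    by (simp add: f_def sum_subtractf x_def y_def sum_distrib_left[symmetric])
  moreover have sq: "(\<Sum>u\<in>UNIV. (f u)\<^sup>2) = 2 * real n * (y\<^sup>2 + x\<^sup>2)"
  proof -
    have "(f u)\<^sup>2 = y\<^sup>2 * (?F u)\<^sup>2 + x\<^sup>2 * (?G u)\<^sup>2 - 2 * x * y * (?F u * ?G u)" for u
      by (simp add: f_def power2_eq_square algebra_simps)
    then show ?thesis unfolding disj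
      by (simp add: sum.distrib sum_distrib_left[symmetric] R1.sum_test_fun_sq R2.sum_test_fun_sq algebra_simps)
  qed
  moreover have "\<theta> * (\<Sum>u\<in>UNIV. (f u)\<^sup>2)
      \<le> (\<Sum>u\<in>UNIV. f u * (\<Sum>i\<in>{1..l}. \<alpha> i * (f (shift i u) + f (inv (shift i) u))))"
  proof -
    have "f u * f (step shift c u) = y\<^sup>2 * (?F u * ?F (step shift c u)) + x\<^sup>2 * (?G u * ?G (step shift c u))"
      if "c \<in> R1.labels" for u c
    proof -
      have "f u * f (step shift c u) = y\<^sup>2 * (?F u * ?F (step shift c u)) + x\<^sup>2 * (?G u * ?G (step shift c u))
          - x * y * (?F u * ?G (step shift c u)) - x * y * (?G u * ?F (step shift c u))"
        by (simp add: f_def power2_eq_square algebra_simps)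
      then show ?thesis unfolding cross[OF that] by simp
    qed
    then have "E f f = y\<^sup>2 * E ?F ?F + x\<^sup>2 * E ?G ?G"
      unfolding E_def by (simp add: sum.distrib sum_distrib_left algebra_simps)
    moreover have "y\<^sup>2 * (2 * real n * \<theta>) + x\<^sup>2 * (2 * real n * \<theta>) \<le> y\<^sup>2 * E ?F ?F + x\<^sup>2 * E ?G ?G"
      by (intro add_mono mult_left_mono E) auto
    moreover have "\<theta> * (\<Sum>u\<in>UNIV. (f u)\<^sup>2) = y\<^sup>2 * (2 * real n * \<theta>) + x\<^sup>2 * (2 * real n * \<theta>)"
      unfolding sq by (simp add: algebra_simps)
    moreover have "E f f = (\<Sum>u\<in>UNIV. f u * (\<Sum>c\<in>R1.labels. \<alpha> (fst c) * f (step shift c u)))"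
      unfolding E_def sum_distrib_left by (subst sum.swap) (simp add: mult_ac)
    moreover have "(\<Sum>c\<in>R1.labels. \<alpha> (fst c) * f (step shift c u))
        = (\<Sum>i\<in>{1..l}. \<alpha> i * (f (shift i u) + f (inv (shift i) u)))" for u
      unfolding R1.labels_def
      by (simp add: sum.cartesian_product' UNIV_bool step_def distrib_left add.commute)
    ultimately show ?thesis by simp
  qed
  ultimately show thesis using that[of f] xy n by (simp add: \<theta>_def sum_power2_gt_zero_iff)
qed

section \<open>Jacobi matrices and their lifts\<close>

lemma cadjoint_inner: "(cadjoint M *v x) \<bullet> z = x \<bullet> (M *v z)"
proof -
  have 1: "(cnj m * c) \<bullet> k = c \<bullet> (m * k)" for m c k :: complex
    by (simp add: inner_complex_def algebra_simps)
  show ?thesis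
    unfolding inner_vec_def matrix_vector_mult_def cadjoint_def
    by (simp add: inner_sum_left inner_sum_right 1) (rule sum.swap)
qed

lemma cadjoint_jacobi: "cadjoint (jacobi G a b) = jacobi G a b"
  by (simp add: vec_eq_iff cadjoint_def jacobi_def insert_commute conj_commute)

lemma matrix_vector_scaleR: "M *v (c *\<^sub>R y) = c *\<^sub>R (M *v y)" for M :: "complex ^ 'n ^ 'm"
  by (simp add: vec_eq_iff matrix_vector_mult_def scaleR_sum_right)

text \<open>A maximum principle: the eigenvalue equations of \<open>z\<close> and of the positive
  vector \<open>w\<close> are compared at a vertex where the modulus of \<open>z\<close> relative to
  \<open>w\<close> is largest.\<close>

lemma jacobi_eigenvalue_le:
  fixes G :: "('v::finite, 'e::finite) mgraph" and w z :: "complex ^ 'v"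
  assumes a: "\<And>e. e \<in> edges G \<Longrightarrow> 0 \<le> a e"
    and w: "\<And>v. w $ v \<in> \<real>" "\<And>v. 0 < Re (w $ v)" "jacobi G a b *v w = complex_of_real t *s w"
    and z: "jacobi G a b *v z = complex_of_real \<mu> *s z" "z \<noteq> 0"
  shows "\<mu> \<le> t"
proof -
  define Y where "Y v = Re (w $ v)" for v
  have wY: "w $ v = of_real (Y v)" for v using w(1)[of v] by (simp add: Y_def complex_is_Real_iff complex_eq_iff)
  have Y: "0 < Y v" for v using w(2) by (simp add: Y_def)
  define m where "m = Max (range (\<lambda>v. norm (z $ v) / Y v))"
  have "m \<in> range (\<lambda>v. norm (z $ v) / Y v)" unfolding m_def by (rule Max_in) auto
  then obtain v where "m = norm (z $ v) / Y v" by auto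
  then have v: "norm (z $ v) = m * Y v" using Y[of v] by simp
  have le: "norm (z $ u) \<le> m * Y u" for u
  proof -
    have "norm (z $ u) / Y u \<le> m" unfolding m_def by (rule Max_ge) auto
    then show ?thesis using Y[of u] by (simp add: divide_simps)
  qed
  have m: "0 < m"
  proof -
    obtain u where "z $ u \<noteq> 0" using z(2) by (auto simp: vec_eq_iff)
    then have "0 < m * Y u" using le[of u] by (meson less_le_trans zero_less_norm_iff)
    then show ?thesis using Y[of u] by (simp add: zero_less_mult_iff)
  qed
  let ?O = "{e. e \<in> edges G \<and> src G e = v}" and ?I = "{e. e \<in> edges G \<and> tgt G e = v}"
  have "complex_of_real (t * Y v) = of_real (b v * Y v + (\<Sum>e\<in>?O. a e * Y (tgt G e)) + (\<Sum>e\<in>?I. a e * Y (src G e)))"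
    using jacobi_apply[of G a b w v] by (simp add: w(3) wY)
  then have t: "(t - b v) * Y v = (\<Sum>e\<in>?O. a e * Y (tgt G e)) + (\<Sum>e\<in>?I. a e * Y (src G e))"
    unfolding of_real_eq_iff by (simp add: left_diff_distrib)
  have "of_real (\<mu> - b v) * z $ v
      = (\<Sum>e\<in>?O. of_real (a e) * z $ tgt G e) + (\<Sum>e\<in>?I. of_real (a e) * z $ src G e)"
    using jacobi_apply[of G a b z v] by (simp add: z(1) left_diff_distrib)
  then have "\<bar>\<mu> - b v\<bar> * norm (z $ v)
      = norm ((\<Sum>e\<in>?O. of_real (a e) * z $ tgt G e) + (\<Sum>e\<in>?I. of_real (a e) * z $ src G e))"
    by (metis norm_mult norm_of_real)
  also have "\<dots> \<le> (\<Sum>e\<in>?O. a e * (m * Y (tgt G e))) + (\<Sum>e\<in>?I. a e * (m * Y (src G e)))"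
    by (intro order_trans[OF norm_triangle_ineq] add_mono sum_norm_le)
       (auto simp: norm_mult a intro!: mult_left_mono le)
  also have "\<dots> = m * ((t - b v) * Y v)"
    unfolding t by (simp add: sum_distrib_left distrib_left mult_ac)
  finally have "\<bar>\<mu> - b v\<bar> * (m * Y v) \<le> (t - b v) * (m * Y v)" by (simp add: v mult_ac)
  then have "\<bar>\<mu> - b v\<bar> \<le> t - b v" using m Y[of v] by simp
  then show ?thesis by simp
qed

section \<open>Transfer between the cover and functions on the skeleton\<close>

lemma spread_inner:
  "bij (\<lambda>w. (blk w, prV w)) \<Longrightarrow> spread blk prV x \<bullet> spread blk prV z = x \<bullet> z"
  unfolding inner_vec_def spread_def
  using sum.reindex_bij_betw[of "\<lambda>w. (blk w, prV w)" UNIV UNIV "\<lambda>p. x $ p \<bullet> z $ p"] by simp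

lemma spread_eq_iff:
  "bij (\<lambda>w. (blk w, prV w)) \<Longrightarrow> spread blk prV x = spread blk prV z \<longleftrightarrow> x = z"
  unfolding vec_eq_iff spread_def by (metis (no_types, lifting) bij_pointE vec_lambda_beta)

lemma spread_linear:
  "spread blk prV (x + z) = spread blk prV x + spread blk prV z"
  "spread blk prV (c *s x) = c *s spread blk prV x"
  by (simp_all add: spread_def vec_eq_iff)

lemma inner_at_vertex: "x \<bullet> z = (\<Sum>u\<in>UNIV. at_vertex x u \<bullet> at_vertex z u)"
  unfolding inner_vec_def at_vertex_def UNIV_Times_UNIV[symmetric]
  by (simp add: sum.cartesian_product' del: UNIV_Times_UNIV)

lemma at_vertex_eqI: "(\<And>u. at_vertex x u = at_vertex z u) \<Longrightarrow> x = z"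
  by (simp add: vec_eq_iff at_vertex_def)

definition tensor :: "('u::finite \<Rightarrow> real) \<Rightarrow> complex ^ 'v::finite \<Rightarrow> complex ^ ('u \<times> 'v)" where
  "tensor f y = (\<chi> p. f (fst p) *\<^sub>R y $ snd p)"

lemma at_vertex_tensor: "at_vertex (tensor f y) u = f u *\<^sub>R y"
  by (simp add: at_vertex_def tensor_def vec_eq_iff)

lemma sum_matrix_vector_mult:
  "(\<Sum>i\<in>I. K i) *v x = (\<Sum>i\<in>I. K i *v x)" for K :: "'i \<Rightarrow> complex ^ 'n ^ 'm"
  by (induction I rule: infinite_finite_induct) (auto simp: matrix_vector_mult_add_rdistrib)

section \<open>The spectral gap of the lift\<close>

theorem corollary1p3:
  fixes G0 :: "('v::finite, 'e::finite) mgraph" and a :: "'e \<Rightarrow> real" and b :: "'v \<Rightarrow> real"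
    and H :: "('w::finite, 'f::finite) mgraph" and prV :: "'w \<Rightarrow> 'v" and prE :: "'f \<Rightarrow> 'e"
    and blk :: "'w \<Rightarrow> 'u::finite" and shift :: "nat \<Rightarrow> 'u \<Rightarrow> 'u"
    and G :: "('u, 'u \<times> nat) mgraph"
    and p l d r j :: nat and es :: "nat \<Rightarrow> 'e"
    and J0 A B :: "complex ^ 'v ^ 'v" and Ai :: "nat \<Rightarrow> complex ^ 'v ^ 'v"
    and J :: "complex ^ ('u \<times> 'v) \<Rightarrow> complex ^ ('u \<times> 'v)"
    and \<epsilon>1 \<epsilon>2 :: "'u \<times> nat" and y :: "complex ^ 'v" and C :: real
  assumes "conn G0" and "CARD('v) = p" and "\<forall>v. degree G0 v \<noteq> 1"
    and "\<forall>e\<in>edges G0. a e > 0" and "J0 = jacobi G0 a b"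
    and "l = betti1 G0" and "d = 2 * l"
    and "inj_on es {1..l}" and "es ` {1..l} \<subseteq> edges G0"
    and "is_tree (del_edges G0 (es ` {1..l}))"
    and "B = jacobi (del_edges G0 (es ` {1..l})) a b"
    and "\<forall>i\<in>{1..l}. Ai i = half_edge G0 a (es i)"
    and "A = (\<Sum>i\<in>{1..l}. Ai i + cadjoint (Ai i))"
    and "lego_cover H G0 prV prE l es blk shift" and "G = skeleton l shift"
    and "\<forall>x. spread blk prV (J x) = jacobi H (a \<circ> prE) (b \<circ> prV) *v spread blk prV x"
    and "\<forall>x u. at_vertex (J x) u = B *v at_vertex x u +
           (\<Sum>i\<in>{1..l}. Ai i *v at_vertex x (shift i u) + cadjoint (Ai i) *v at_vertex x (inv (shift i) u))"
    and "r \<ge> 1" and "j \<in> {1..l}"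
    and "\<epsilon>1 \<in> edges G" and "Ai (snd \<epsilon>1) = Ai j \<or> Ai (snd \<epsilon>1) = cadjoint (Ai j)"
    and "\<epsilon>2 \<in> edges G" and "Ai (snd \<epsilon>2) = Ai j \<or> Ai (snd \<epsilon>2) = cadjoint (Ai j)"
    and "\<forall>u\<in>ends G \<epsilon>1. \<forall>u'\<in>ends G \<epsilon>2. gdist G u u' > enat (2 * r + 2)"
    and "perron_frobenius J0 y"
    and "C = (2 * sqrt (real d - 1) - 1) * ((A *v y) \<bullet> y / real d)
             + \<bar>(A *v y) \<bullet> y / real d - (Ai j *v y) \<bullet> y\<bar>"
  shows "eigval 1 J - eigval 2 J
           \<le> (real d - 2 * sqrt (real d - 1)) * ((A *v y) \<bullet> y / real d) + C / real r"
  (is "?gap \<le> ?bound")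
proof -
  let ?E = "es ` {1..l}" and ?M = "jacobi H (a \<circ> prE) (b \<circ> prV)"
  note lego = \<open>lego_cover H G0 prV prE l es blk shift\<close>
  note Jblock = \<open>\<forall>x u. at_vertex (J x) u = B *v at_vertex x u +
           (\<Sum>i\<in>{1..l}. Ai i *v at_vertex x (shift i u) + cadjoint (Ai i) *v at_vertex x (inv (shift i) u))\<close>
  note Jlift = \<open>\<forall>x. spread blk prV (J x) = ?M *v spread blk prV x\<close>
  have cov: "is_cover H G0 prV prE" and bb: "bij (\<lambda>w. (blk w, prV w))"
    and bs: "\<And>i. i \<in> {1..l} \<Longrightarrow> bij (shift i)"
    using lego by (auto simp: lego_cover_def)
  have aH: "0 \<le> (a \<circ> prE) f" if "f \<in> edges H" for f
    using cov that \<open>\<forall>e\<in>edges G0. a e > 0\<close> by (auto simp: is_cover_def intro: less_imp_le)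

  define t where "t = eigval 1 ((*v) J0)"
  have y: "norm y = 1" "\<And>v. y $ v \<in> \<real>" "\<And>v. 0 < Re (y $ v)" "J0 *v y = t *\<^sub>R y"
    using \<open>perron_frobenius J0 y\<close> by (auto simp: perron_frobenius_def t_def of_real_vector_mult)
  have yy: "y \<bullet> y = 1" by (simp add: dot_square_norm y(1))
  define \<alpha> where "\<alpha> i = (Ai i *v y) \<bullet> y" for i
  define \<beta> where "\<beta> = (B *v y) \<bullet> y"
  have adj: "(cadjoint (Ai i) *v y) \<bullet> y = \<alpha> i" for i
    unfolding \<alpha>_def cadjoint_inner by (rule inner_commute)
  have \<alpha>_nonneg: "0 \<le> \<alpha> i" if i: "i \<in> {1..l}" for i
  proof -
    have "es i \<in> edges G0" using i \<open>?E \<subseteq> edges G0\<close> by auto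
    then have "0 < a (es i)" using \<open>\<forall>e\<in>edges G0. a e > 0\<close> by blast
    moreover have "Im (y $ v) = 0" for v using y(2)[of v] by (simp add: complex_is_Real_iff)
    ultimately show ?thesis
      using i y(3) \<open>\<forall>i\<in>{1..l}. Ai i = half_edge G0 a (es i)\<close>
      by (auto simp: \<alpha>_def inner_vec_def half_edge_apply inner_complex_def less_imp_le intro!: sum_nonneg)
  qed
  have Ay: "(A *v y) \<bullet> y = 2 * (\<Sum>i\<in>{1..l}. \<alpha> i)"
    unfolding \<open>A = (\<Sum>i\<in>{1..l}. Ai i + cadjoint (Ai i))\<close> sum_matrix_vector_mult
    by (simp add: matrix_vector_mult_add_rdistrib inner_sum_left inner_add_left adj sum.distrib sum_distrib_left
        flip: \<alpha>_def)
  have J0: "J0 = B + A"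
    using jacobi_split[OF \<open>inj_on es {1..l}\<close> \<open>?E \<subseteq> edges G0\<close>, of a b]
      \<open>\<forall>i\<in>{1..l}. Ai i = half_edge G0 a (es i)\<close>
    unfolding \<open>J0 = jacobi G0 a b\<close> \<open>B = jacobi (del_edges G0 ?E) a b\<close>
      \<open>A = (\<Sum>i\<in>{1..l}. Ai i + cadjoint (Ai i))\<close> by simp
  have l: "1 \<le> l" using \<open>j \<in> {1..l}\<close> by simp
  \<comment> \<open>The mean of the \<open>\<alpha> i\<close>, since each of them enters
    \<open>A\<close> twice and \<open>d = 2 * l\<close>.\<close>
  define s where "s = (A *v y) \<bullet> y / real d"
  have s: "s * real l = (\<Sum>i\<in>{1..l}. \<alpha> i)"
    using l by (simp add: s_def Ay \<open>d = 2 * l\<close>)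
  have t: "t = \<beta> + 2 * real l * s"
  proof -
    have "t = (J0 *v y) \<bullet> y" by (simp add: y(4) yy)
    also have "\<dots> = \<beta> + (A *v y) \<bullet> y"
      by (simp add: J0 matrix_vector_mult_add_rdistrib inner_add_left \<beta>_def)
    finally show ?thesis unfolding Ay s[symmetric] by simp
  qed

  have lin: "Vector_Spaces.linear (*s) (*s) J"
  proof unfold_locales
    show "J (x + z) = J x + J z" for x z
      by (simp add: Jlift spread_linear matrix_vector_right_distrib flip: spread_eq_iff[OF bb])
    show "J (c *s x) = c *s J x" for c x
      by (simp add: Jlift spread_linear vector_scalar_commute flip: spread_eq_iff[OF bb])
  qed
  have sa: "J x \<bullet> z = x \<bullet> J z" for x z
    using cadjoint_inner[of ?M "spread blk prV x" "spread blk prV z"]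
    by (simp add: cadjoint_jacobi Jlift flip: spread_inner[OF bb])
  define w where "w = tensor (\<lambda>_::'u. 1) y"
  have w: "J w = complex_of_real t *s w"
  proof (rule at_vertex_eqI)
    fix u
    have "at_vertex (J w) u = B *v y + A *v y"
      unfolding \<open>A = (\<Sum>i\<in>{1..l}. Ai i + cadjoint (Ai i))\<close> sum_matrix_vector_mult
      by (simp add: Jblock w_def at_vertex_tensor matrix_vector_mult_add_rdistrib)
    also have "\<dots> = t *\<^sub>R y" using y(4) by (simp add: J0 matrix_vector_mult_add_rdistrib)
    finally show "at_vertex (J w) u = at_vertex (complex_of_real t *s w) u"
      by (simp add: at_vertex_def w_def tensor_def vec_eq_iff scaleR_conv_of_real[where 'a = complex])
  qed
  \<comment> \<open>On the cover, the lift of \<open>y\<close> is a positive eigenvector of a Jacobi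
    matrix with positive edge weights, so the maximum principle applies there.\<close>
  have max: "\<mu> \<le> t" if x: "x \<noteq> 0" "J x = complex_of_real \<mu> *s x" for x \<mu>
  proof (rule jacobi_eigenvalue_le[OF aH])
    show "?M *v spread blk prV w = complex_of_real t *s spread blk prV w"
      by (metis Jlift w spread_linear(2))
    show "?M *v spread blk prV x = complex_of_real \<mu> *s spread blk prV x"
      by (metis Jlift x(2) spread_linear(2))
    show "spread blk prV x \<noteq> 0"
      using x(1) spread_inner[OF bb, of x x] by auto
  qed (auto simp: spread_def w_def tensor_def y)

  \<comment> \<open>Different labels may carry equal matrices, so the label of the edge can differ
    from \<open>j\<close>; its weight \<open>\<alpha> i\<close> is still
    \<open>\<alpha> j\<close>.\<close>
  have edge: "\<exists>u i. \<epsilon> = (u, i) \<and> i \<in> {1..l} \<and> \<alpha> i = \<alpha> j \<and> ends G \<epsilon> = {u, shift i u}"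
    if "\<epsilon> \<in> edges G" "Ai (snd \<epsilon>) = Ai j \<or> Ai (snd \<epsilon>) = cadjoint (Ai j)" for \<epsilon>
    using that adj[of j] \<open>G = skeleton l shift\<close>
    by (cases \<epsilon>) (auto simp: skeleton_def ends_def \<alpha>_def)
  obtain u1 j1 where 1: "j1 \<in> {1..l}" "\<alpha> j1 = \<alpha> j" "ends G \<epsilon>1 = {u1, shift j1 u1}"
    using edge[OF \<open>\<epsilon>1 \<in> edges G\<close> \<open>Ai (snd \<epsilon>1) = Ai j \<or> Ai (snd \<epsilon>1) = cadjoint (Ai j)\<close>] by blast
  obtain u2 j2 where 2: "j2 \<in> {1..l}" "\<alpha> j2 = \<alpha> j" "ends G \<epsilon>2 = {u2, shift j2 u2}"
    using edge[OF \<open>\<epsilon>2 \<in> edges G\<close> \<open>Ai (snd \<epsilon>2) = Ai j \<or> Ai (snd \<epsilon>2) = cadjoint (Ai j)\<close>] by blast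
  have far: "\<forall>x1\<in>{u1, shift j1 u1}. \<forall>x2\<in>{u2, shift j2 u2}. gdist (skeleton l shift) x1 x2 > enat (2 * r)"
  proof (intro ballI)
    fix x1 x2 assume "x1 \<in> {u1, shift j1 u1}" "x2 \<in> {u2, shift j2 u2}"
    then have "enat (2 * r + 2) < gdist (skeleton l shift) x1 x2"
      using \<open>\<forall>u\<in>ends G \<epsilon>1. \<forall>u'\<in>ends G \<epsilon>2. gdist G u u' > enat (2 * r + 2)\<close> 1(3) 2(3)
        \<open>G = skeleton l shift\<close> by blast
    then show "enat (2 * r) < gdist (skeleton l shift) x1 x2"
      by (rule le_less_trans[rotated]) simp
  qed
  define q where "q = sqrt (2 * real l - 1)"
  define \<theta> where "\<theta> = 2 * q * s - ((2 * q - 1) * s + \<bar>s - \<alpha> j\<bar>) / real r"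
  have "rooted_skeleton shift l j1" "rooted_skeleton shift l j2"
    using bs 1(1) 2(1) by (simp_all add: rooted_skeleton_def)
  from two_test_funs[OF this far \<alpha>_nonneg 1(2) 2(2) s \<open>r \<ge> 1\<close>]
  obtain f where f: "(\<Sum>u\<in>UNIV. f u) = 0" "0 < (\<Sum>u\<in>UNIV. (f u)\<^sup>2)"
    "\<theta> * (\<Sum>u\<in>UNIV. (f u)\<^sup>2)
     \<le> (\<Sum>u\<in>UNIV. f u * (\<Sum>i\<in>{1..l}. \<alpha> i * (f (shift i u) + f (inv (shift i) u))))"
    unfolding \<theta>_def q_def by blast
  define z where "z = tensor f y"
  have zz: "z \<bullet> z = (\<Sum>u\<in>UNIV. (f u)\<^sup>2)"
    by (simp add: inner_at_vertex z_def at_vertex_tensor yy power2_eq_square)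
  have zw: "z \<bullet> w = 0"
    using f(1) by (simp add: inner_at_vertex z_def w_def at_vertex_tensor yy)
  \<comment> \<open>Both vectors have real entries, so their Hermitian product has no imaginary
    part.\<close>
  have ziw: "z \<bullet> (\<i> *s w) = 0"
    using y(2) by (auto simp: inner_vec_def inner_complex_def z_def w_def tensor_def complex_is_Real_iff)
  have "J z \<bullet> z = (\<Sum>u\<in>UNIV. f u * (f u * \<beta> + (\<Sum>i\<in>{1..l}. \<alpha> i * (f (shift i u) + f (inv (shift i) u)))))"
    unfolding inner_at_vertex
    by (rule sum.cong)
       (simp_all add: Jblock z_def at_vertex_tensor matrix_vector_scaleR inner_add_left inner_sum_left adj
          distrib_left mult.commute flip: \<alpha>_def \<beta>_def)
  also have "\<dots> = \<beta> * (z \<bullet> z)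
      + (\<Sum>u\<in>UNIV. f u * (\<Sum>i\<in>{1..l}. \<alpha> i * (f (shift i u) + f (inv (shift i) u))))"
    unfolding zz by (simp add: distrib_left sum.distrib power2_eq_square sum_distrib_left mult_ac)
  finally have "(\<beta> + \<theta>) * (z \<bullet> z) \<le> J z \<bullet> z"
    using f(3) by (simp add: zz distrib_right)
  moreover have "z \<noteq> 0" using f(2) unfolding zz[symmetric] by simp
  moreover have "w \<bullet> w \<noteq> 0"
    by (simp add: inner_at_vertex w_def at_vertex_tensor yy)
  then have "w \<noteq> 0" by auto
  ultimately have "eigval 1 J \<le> t" "\<beta> + \<theta> \<le> eigval 2 J"
    using eigval_bounds[OF lin sa w _ max zw ziw] by auto
  \<comment> \<open>The tree part \<open>\<beta>\<close> of the energy occurs in both bounds and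
    cancels.\<close>
  then have "?gap \<le> 2 * real l * s - \<theta>" by (simp add: t)
  also have "\<dots> = ?bound"
    unfolding \<open>C = (2 * sqrt (real d - 1) - 1) * ((A *v y) \<bullet> y / real d)
             + \<bar>(A *v y) \<bullet> y / real d - (Ai j *v y) \<bullet> y\<bar>\<close> s_def[symmetric] \<alpha>_def[symmetric]
    by (simp add: \<theta>_def q_def \<open>d = 2 * l\<close> algebra_simps)
  finally show ?thesis .
qed

end
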